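(* Let $n\ge 1$ be an integer. For any $0<\alpha\le 1$ and any $0<\delta\le 1/2$, $$\min\bigl\{\mathcal L^n\bigl(N_\delta[A]\bigr): A\subseteq\mathbb R^n/\mathbb Z^n \text{ measurable},\ \mathcal L^n(A)\ge\alpha\bigr\}=\min_{t\in\{1,\dots,n\}}\Bigl\{1,\ \bigl(\alpha^{1/t}+2\delta\bigr)^t,\ 1-\bigl(\max\{0,(1-\alpha)^{1/t}-2\delta\}\bigr)^t\Bigr\}.$$ (In particular the minimum on the left is attained.)
   Context: $\mathcal L^n$ denotes the probability measure on the torus $\mathbb R^n/\mathbb Z^n$ induced by Lebesgue measure on $[0,1)^n$. For $A\subseteq\mathbb R^n/\mathbb Z^n$, $N_\delta[A]\subseteq\mathbb R^n/\mathbb Z^n$ is the set of all points of the torus at distance strictly less than $\delta$ from some point of $A$ in the quotient of the $\ell_\infty$ metric; equivalently, it is the image in $\mathbb R^n/\mathbb Z^n$ of $\{x\in\mathbb R^n:\|x-a\|_\infty<\delta\text{ for some }a\in\widetilde A\}$, where $\widetilde A\subseteq\mathbb R^n$ is the $\mathbb Z^n$-periodic preimage of $A$. The right-hand side is the minimum over all the listed quantities as $t$ ranges over $\{1,\dots,n\}$. *)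

theory Defs
  imports "HOL-Analysis.Analysis"
begin

definition torus_rel :: "real ^ 'n \<Rightarrow> real ^ 'n \<Rightarrow> bool" where
  "torus_rel x y \<longleftrightarrow> (\<forall>i. x $ i - y $ i \<in> \<int>)"

lemma equivp_torus_rel: "equivp (torus_rel :: real ^ 'n \<Rightarrow> real ^ 'n \<Rightarrow> bool)"
proof (rule equivpI)
  show "reflp (torus_rel :: real ^ 'n \<Rightarrow> real ^ 'n \<Rightarrow> bool)"
    by (simp add: reflp_def torus_rel_def)
  show "symp (torus_rel :: real ^ 'n \<Rightarrow> real ^ 'n \<Rightarrow> bool)"
    unfolding symp_def torus_rel_def by (metis Ints_minus minus_diff_eq)
  show "transp (torus_rel :: real ^ 'n \<Rightarrow> real ^ 'n \<Rightarrow> bool)"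
  proof (rule transpI)
    fix x y z :: "real ^ 'n" assume "torus_rel x y" "torus_rel y z"
    then have "(x $ i - y $ i) + (y $ i - z $ i) \<in> \<int>" for i
      unfolding torus_rel_def by (meson Ints_add)
    then show "torus_rel x z" by (simp add: torus_rel_def)
  qed
qed

quotient_type 'n torus = "real ^ ('n::finite)" / torus_rel
  morphisms torus_rep torus_proj
  by (rule equivp_torus_rel)

definition unit_cube :: "(real ^ 'n) set" where
  "unit_cube = {x. \<forall>i. 0 \<le> x $ i \<and> x $ i < 1}"

(* The push-forward of Lebesgue measure on [0,1)^n under the projection, on the
   largest sigma-algebra that makes the projection measurable; measurability of
   a subset of the torus is therefore Lebesgue (not just Borel) measurability. *)
definition torus_measure :: "('n::finite) torus measure" where
  "torus_measure =
     distr (restrict_space lebesgue unit_cube)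
       (sigma UNIV {A. torus_proj -` A \<inter> unit_cube \<in> sets lebesgue}) torus_proj"

(* infnorm is the l_infinity norm on real ^ 'n. *)
definition torus_dist :: "('n::finite) torus \<Rightarrow> 'n torus \<Rightarrow> real" where
  "torus_dist p q = Inf {infnorm (x - y) | x y. torus_proj x = p \<and> torus_proj y = q}"

definition torus_nbhd :: "real \<Rightarrow> ('n::finite) torus set \<Rightarrow> 'n torus set" where
  "torus_nbhd \<delta> A = {p. \<exists>a\<in>A. torus_dist p a < \<delta>}"

definition is_minimum :: "real \<Rightarrow> real set \<Rightarrow> bool" where
  "is_minimum m S \<longleftrightarrow> m \<in> S \<and> (\<forall>s\<in>S. m \<le> s)"

lemma unit_cube_lebesgue: "(unit_cube :: (real ^ 'n) set) \<in> sets lebesgue"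
proof -
  have "(unit_cube :: (real ^ 'n) set) = (\<Inter>i. {x. 0 \<le> x $ i} \<inter> {x. x $ i < 1})"
    by (auto simp: unit_cube_def)
  moreover have "{x :: real ^ 'n. 0 \<le> x $ i} \<inter> {x. x $ i < 1} \<in> sets lebesgue" for i
    by (intro sets.Int sets_completionI_sets sets_lborel [THEN equalityD2, THEN subsetD]
        borel_closed borel_open closed_Collect_le open_Collect_less continuous_intros)
  ultimately show ?thesis
    by (metis (no_types, lifting) sets.finite_INT finite UNIV_not_empty)
qed

lemma space_torus_measure [simp]: "space torus_measure = UNIV"
  by (simp add: torus_measure_def)

lemma sigma_algebra_torus:
  "sigma_algebra UNIV {A. (torus_proj :: real ^ 'n \<Rightarrow> 'n torus) -` A \<inter> unit_cube \<in> sets lebesgue}"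
proof (unfold sigma_algebra_iff2, intro conjI ballI allI impI)
  let ?S = "{A. (torus_proj :: real ^ 'n \<Rightarrow> 'n torus) -` A \<inter> unit_cube \<in> sets lebesgue}"
  fix A assume "A \<in> ?S"
  then have "unit_cube - ((torus_proj :: real ^ 'n \<Rightarrow> 'n torus) -` A \<inter> unit_cube) \<in> sets lebesgue"
    using unit_cube_lebesgue by blast
  moreover have "unit_cube - ((torus_proj :: real ^ 'n \<Rightarrow> 'n torus) -` A \<inter> unit_cube)
      = torus_proj -` (UNIV - A) \<inter> unit_cube" by auto
  ultimately show "UNIV - A \<in> ?S" by simp
next
  let ?S = "{A. (torus_proj :: real ^ 'n \<Rightarrow> 'n torus) -` A \<inter> unit_cube \<in> sets lebesgue}"
  fix A :: "nat \<Rightarrow> 'n torus set" assume "range A \<subseteq> ?S"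
  then have "(\<Union>i. (torus_proj :: real ^ 'n \<Rightarrow> 'n torus) -` A i \<inter> unit_cube) \<in> sets lebesgue"
    by (intro sets.countable_UN) auto
  moreover have "(\<Union>i. (torus_proj :: real ^ 'n \<Rightarrow> 'n torus) -` A i \<inter> unit_cube)
      = torus_proj -` (\<Union>i. A i) \<inter> unit_cube" by auto
  ultimately show "(\<Union>i. A i) \<in> ?S" by simp
qed auto

lemma sets_torus_measure:
  "A \<in> sets torus_measure \<longleftrightarrow> torus_proj -` A \<inter> unit_cube \<in> sets lebesgue"
  unfolding torus_measure_def
  by (simp add: sigma_algebra.sigma_sets_eq [OF sigma_algebra_torus])

lemma torus_proj_measurable:
  "(torus_proj :: real ^ 'n \<Rightarrow> 'n torus) \<in> restrict_space lebesgue unit_cube \<rightarrow>\<^sub>M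
     sigma UNIV {A. torus_proj -` A \<inter> unit_cube \<in> sets lebesgue}"
proof (rule measurableI)
  fix A assume "A \<in> sets (sigma UNIV {A. (torus_proj :: real ^ 'n \<Rightarrow> 'n torus) -` A \<inter> unit_cube \<in> sets lebesgue})"
  then have "(torus_proj :: real ^ 'n \<Rightarrow> 'n torus) -` A \<inter> unit_cube \<in> sets lebesgue"
    by (simp add: sigma_algebra.sigma_sets_eq [OF sigma_algebra_torus])
  then show "(torus_proj :: real ^ 'n \<Rightarrow> 'n torus) -` A \<inter> space (restrict_space lebesgue unit_cube)
      \<in> sets (restrict_space lebesgue unit_cube)"
    by (simp add: sets_restrict_space_iff unit_cube_lebesgue space_restrict_space)
qed auto

lemma emeasure_torus_measure:
  assumes "A \<in> sets torus_measure"
  shows "emeasure torus_measure A = emeasure lebesgue (torus_proj -` A \<inter> unit_cube)"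
proof -
  have A: "A \<in> sets (sigma UNIV {A. torus_proj -` A \<inter> unit_cube \<in> sets lebesgue})"
    using assms by (simp add: torus_measure_def)
  show ?thesis
    unfolding torus_measure_def
    by (subst emeasure_distr [OF torus_proj_measurable A])
       (simp add: emeasure_restrict_space unit_cube_lebesgue space_restrict_space)
qed

lemma emeasure_torus_measure_UNIV: "emeasure (torus_measure :: ('n::finite) torus measure) UNIV = 1"
proof -
  have "box 0 One \<subseteq> (unit_cube :: (real ^ 'n) set)" "(unit_cube :: (real ^ 'n) set) \<subseteq> cbox 0 One"
    by (simp_all add: unit_cube_def mem_box_cart subset_iff less_imp_le cart_eq_inner_axis inner_sum_Basis axis_in_Basis_iff)
  then have "emeasure lebesgue (box 0 One :: (real ^ 'n) set) \<le> emeasure lebesgue (unit_cube :: (real ^ 'n) set)"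
    "emeasure lebesgue (unit_cube :: (real ^ 'n) set) \<le> emeasure lebesgue (cbox 0 One :: (real ^ 'n) set)"
    by (intro emeasure_mono; simp add: unit_cube_lebesgue)+
  moreover have "emeasure lebesgue (box 0 One :: (real ^ 'n) set) = 1"
    "emeasure lebesgue (cbox 0 One :: (real ^ 'n) set) = 1"
    by (simp_all add: emeasure_lborel_box_eq emeasure_lborel_cbox_eq)
  ultimately have "emeasure lebesgue (unit_cube :: (real ^ 'n) set) = 1"
    by (metis antisym)
  then show ?thesis
    by (subst emeasure_torus_measure) (simp_all add: sets_torus_measure unit_cube_lebesgue)
qed

lemma torus_nbhd_eq_image:
  "torus_nbhd \<delta> A = torus_proj ` {x. \<exists>a\<in>torus_proj -` A. infnorm (x - a) < \<delta>}"
proof (rule set_eqI)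
  fix p :: "'a torus"
  have rep: "torus_proj (torus_rep q) = q" for q :: "'a torus"
    by (rule Quotient_abs_rep [OF Quotient_torus])
  have "torus_dist p a < \<delta> \<longleftrightarrow> (\<exists>x y. torus_proj x = p \<and> torus_proj y = a \<and> infnorm (x - y) < \<delta>)" for a
  proof -
    let ?D = "{infnorm (x - y) | x y. torus_proj x = p \<and> torus_proj y = a}"
    have "infnorm (torus_rep p - torus_rep a) \<in> ?D"
      by (intro CollectI exI conjI) (rule refl rep)+
    then have "?D \<noteq> {}" by (metis empty_iff)
    moreover have "bdd_below ?D" by (rule bdd_belowI [of _ 0]) (auto simp: infnorm_pos_le)
    ultimately have "Inf ?D < \<delta> \<longleftrightarrow> (\<exists>d\<in>?D. d < \<delta>)" by (rule cInf_less_iff)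
    then show ?thesis unfolding torus_dist_def by auto
  qed
  then have "p \<in> torus_nbhd \<delta> A \<longleftrightarrow>
      (\<exists>a\<in>A. \<exists>x y. torus_proj x = p \<and> torus_proj y = a \<and> infnorm (x - y) < \<delta>)"
    by (simp add: torus_nbhd_def)
  also have "\<dots> \<longleftrightarrow> p \<in> torus_proj ` {x. \<exists>a\<in>torus_proj -` A. infnorm (x - a) < \<delta>}"
    unfolding image_iff Bex_def mem_Collect_eq vimage_eq by metis
  finally show "p \<in> torus_nbhd \<delta> A \<longleftrightarrow>
      p \<in> torus_proj ` {x. \<exists>a\<in>torus_proj -` A. infnorm (x - a) < \<delta>}" .
qed

end

theory Submission
  imports Defs "HOL-Real_Asymp.Real_Asymp"
begin

text \<open>
  Write \<open>d = 2 * \<delta>\<close> and \<open>n\<close> for the dimension. The right-hand side of the theorem, as a function of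
  the volume \<open>\<alpha>\<close>, is called the profile. It is attained by cubes in \<open>t\<close> of the coordinates, by
  complements of such cubes or by the whole torus (\<open>cube_attains\<close>, \<open>cocube_attains\<close>); the point is the lower bound.

  The lower bound is combinatorial. Overlay a grid of side \<open>1 / m\<close> and replace \<open>A\<close> by the set of cells
  that meet it. This does not decrease the volume, and a discrete neighbourhood of these cells, with
  a radius smaller by one cell, is contained in the neighbourhood of \<open>A\<close>. So it suffices to bound
  neighbourhoods in powers of a finite cycle by the profile (\<open>product_growth\<close>) and to let
  \<open>m\<close> tend to infinity (\<open>torus_nbhd_lower_bound\<close>).

  In the discrete setting one inducts on the dimension by slicing along one coordinate. The slice of
  the neighbourhood over \<open>y\<close> contains the neighbourhood of every slice over a point near \<open>y\<close>. On the
  cycle a set of \<open>j\<close> points has at least \<open>j + K\<close> neighbours, so that rearranging slices by size and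
  using that the profile \<open>f\<close> in dimension \<open>n\<close> is concave reduces everything to two-level sets: slices
  of volume \<open>M\<close> over an interval of length \<open>c\<close> and of volume \<open>u \<le> M\<close> elsewhere
  (\<open>averaged_growth\<close>). What remains is an inequality between numbers,
  \<open>(1 - c - d) * f u + (c + d) * f M \<ge> F (u + c * (M - u))\<close>, where \<open>F\<close> is the profile in dimension
  \<open>n + 1\<close> (\<open>profile_two_level\<close>).

  For fixed \<open>c\<close> and fixed total volume the left-hand side is concave in \<open>(u, M)\<close>, so only the extreme
  cases \<open>u = M\<close>, \<open>u = 0\<close> and \<open>M = 1\<close> matter: these are the product of an interval with an optimal set
  and the union of a slab with an optimal set. If the optimal set is of the matching kind, Hoelder's
  inequality finishes. If it is of the other kind (an interval times the complement of a cube,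
  say), the set can be sliced in another direction, where it is again a two-level set but not an
  extreme one. By concavity it then cannot be a minimiser that beats the profile
  (\<open>profile_product_step\<close>).
\<close>

section \<open>Growth of cubes and co-cubes\<close>

text \<open>Convexity of the power function, at the points \<open>x / z\<close> and \<open>1\<close> with weights
  \<open>z / (z + d)\<close> and \<open>d / (z + d)\<close>. This one form of Hoelder's inequality gives both the
  concavity of \<open>cube_growth\<close> and the fact that, among boxes of a given volume, the
  cube grows least.\<close>

lemma holder_power_shift:
  fixes x z d :: real
  assumes "0 < z" "0 \<le> x" "0 \<le> d"
  shows "(x + d) ^ Suc t \<le> (x ^ Suc t / z ^ t + d) * (z + d) ^ t"
proof -
  have conv: "convex_on {0..} (\<lambda>x::real. x ^ Suc t)"
  proof (rule convex_on_realI[where f' = "\<lambda>x. real (Suc t) * x ^ t"])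
    show "((\<lambda>x. x ^ Suc t) has_real_derivative real (Suc t) * x ^ t) (at x)" for x :: real
      using DERIV_pow[of "Suc t" x] by simp
  qed (auto intro!: mult_left_mono power_mono simp del: of_nat_Suc)
  let ?m = "d / (z + d)"
  have zd: "z + d > 0" using assms by simp
  have m: "0 \<le> ?m" "?m \<le> 1" using assms by (auto simp: divide_simps)
  have w: "1 - ?m = z / (z + d)" using zd by (simp add: field_simps)
  have "((1 - ?m) *\<^sub>R (x / z) + ?m *\<^sub>R 1) ^ Suc t \<le> (1 - ?m) * (x / z) ^ Suc t + ?m * 1 ^ Suc t"
    using convex_onD[OF conv m, of "x / z" 1] assms by simp
  moreover have "(1 - ?m) *\<^sub>R (x / z) + ?m *\<^sub>R 1 = (x + d) / (z + d)"
    unfolding w using assms(1) by (simp add: add_divide_distrib)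
  ultimately have "((x + d) / (z + d)) ^ Suc t \<le> z / (z + d) * (x / z) ^ Suc t + d / (z + d)"
    unfolding w by simp
  then have "((x + d) / (z + d)) ^ Suc t * (z + d) ^ Suc t
      \<le> (z / (z + d) * (x / z) ^ Suc t + d / (z + d)) * (z + d) ^ Suc t"
    using zd by (intro mult_right_mono) auto
  also have "((x + d) / (z + d)) ^ Suc t * (z + d) ^ Suc t = (x + d) ^ Suc t"
    using zd by (simp add: power_divide del: power_Suc)
  also have "(z / (z + d) * (x / z) ^ Suc t + d / (z + d)) * (z + d) ^ Suc t
      = (x ^ Suc t / z ^ t + d) * (z + d) ^ t"
  proof -
    have "z / (z + d) * (x / z) ^ Suc t + d / (z + d) = (x ^ Suc t / z ^ t + d) / (z + d)"
      using assms(1) by (simp add: power_divide add_divide_distrib)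
    then show ?thesis using zd by simp
  qed
  finally show ?thesis .
qed

text \<open>The volume of the neighbourhood of a cube of volume \<open>a\<close> in dimension \<open>t\<close>, respectively of the
  complement of a cube when that complement has volume \<open>a\<close>; \<open>d\<close> is the increase of the
  side length, twice the radius.\<close>

definition cube_growth :: "real \<Rightarrow> nat \<Rightarrow> real \<Rightarrow> real" where
  "cube_growth d t a = (root t a + d) ^ t"

definition cocube_growth :: "real \<Rightarrow> nat \<Rightarrow> real \<Rightarrow> real" where
  "cocube_growth d t a = 1 - (max 0 (root t (1 - a) - d)) ^ t"

text \<open>The optimum in dimension \<open>n\<close> as a function of the volume \<open>a\<close>. The value at \<open>a = 0\<close>
  is the limit from the right, not the volume \<open>0\<close> of an empty neighbourhood: this keeps
  the profile continuous, and the empty set is treated through \<open>profile0\<close>.\<close>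

fun profile :: "real \<Rightarrow> nat \<Rightarrow> real \<Rightarrow> real" where
  "profile d 0 a = 1"
| "profile d (Suc n) a =
     min (profile d n a) (min (cube_growth d (Suc n) a) (cocube_growth d (Suc n) a))"

lemma cube_growth_mono:
  "\<lbrakk>0 \<le> a; a \<le> b; 0 \<le> d; 0 < t\<rbrakk> \<Longrightarrow> cube_growth d t a \<le> cube_growth d t b"
  unfolding cube_growth_def by (intro power_mono add_right_mono) auto

lemma cocube_growth_mono:
  "\<lbrakk>a \<le> b; 0 \<le> d; 0 < t\<rbrakk> \<Longrightarrow> cocube_growth d t a \<le> cocube_growth d t b"
  unfolding cocube_growth_def
  by (intro diff_left_mono power_mono max.mono diff_right_mono) auto

lemma cube_growth_power:
  assumes "0 \<le> x" "0 < t" shows "cube_growth d t (x ^ t) = (x + d) ^ t"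
  unfolding cube_growth_def using assms by (simp add: real_root_power_cancel)

text \<open>The right-hand side of \<open>holder_power_shift\<close> is affine in \<open>x ^ Suc t\<close>, with equality at \<open>x = z\<close>:
  it is the tangent line of the growth function at \<open>z ^ Suc t\<close>, and a function below its
  tangents is concave.\<close>

lemma cube_growth_concave:
  assumes d: "0 \<le> d" and t: "0 < t"
  shows "concave_on {0..} (cube_growth d t)"
  unfolding concave_on_iff
proof (intro conjI ballI allI impI)
  fix a b u v :: real
  assume ab: "a \<in> {0..}" "b \<in> {0..}" and uv: "0 \<le> u" "0 \<le> v" "u + v = 1"
  obtain s where s: "t = Suc s" using t gr0_conv_Suc by auto
  define x y z where "x = root t a" and "y = root t b" and "z = root t (u * a + v * b)"
  have nn: "0 \<le> x" "0 \<le> y" "0 \<le> z" using ab uv t by (auto simp: x_def y_def z_def)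
  have pw: "x ^ t = a" "y ^ t = b" "z ^ t = u * a + v * b"
    using ab uv t by (auto simp: x_def y_def z_def)
  have "u * (x + d) ^ t + v * (y + d) ^ t \<le> (z + d) ^ t"
  proof (cases "z = 0")
    case True
    then have "u * a + v * b = 0" using pw(3) t by (simp add: zero_power)
    moreover have "0 \<le> u * a" "0 \<le> v * b" using ab uv by auto
    ultimately have "u * a = 0" "v * b = 0" by linarith+
    then have "u * (x + d) ^ t = u * d ^ t" "v * (y + d) ^ t = v * d ^ t"
      by (auto simp: x_def y_def)
    then have "u * (x + d) ^ t + v * (y + d) ^ t = (u + v) * d ^ t"
      by (simp only: distrib_right)
    then show ?thesis using True uv by simp
  next
    case False
    then have z: "0 < z" using nn by simp
    have "(u * (x + d) ^ t + v * (y + d) ^ t)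
        \<le> u * ((x ^ t / z ^ s + d) * (z + d) ^ s) + v * ((y ^ t / z ^ s + d) * (z + d) ^ s)"
      unfolding s using uv nn d z by (intro add_mono mult_left_mono holder_power_shift) auto
    also have "\<dots> = ((u * x ^ t + v * y ^ t) / z ^ s + (u + v) * d) * (z + d) ^ s"
      by (simp add: algebra_simps add_divide_distrib)
    also have "u * x ^ t + v * y ^ t = z * z ^ s" using pw s by simp
    also have "(z * z ^ s / z ^ s + (u + v) * d) * (z + d) ^ s = (z + d) ^ t"
      using z uv s by simp
    finally show ?thesis .
  qed
  then show "u * cube_growth d t a + v * cube_growth d t b \<le> cube_growth d t (u *\<^sub>R a + v *\<^sub>R b)"
    by (simp add: cube_growth_def x_def y_def z_def)
qed simp

text \<open>Growing a cube and growing its complement are inverse operations, since the cube that is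
  left over grows back to the original one. In this adjoint form the truncation at side length
  zero needs no case distinction.\<close>

lemma cocube_growth_ge_iff:
  assumes "0 \<le> d" "0 < t" "0 \<le> x" "a \<le> 1"
  shows "1 - x \<le> cocube_growth d t a \<longleftrightarrow> 1 - a \<le> cube_growth d t x"
proof -
  define r where "r = root t (1 - a)"
  define q where "q = root t x"
  have r: "0 \<le> r" "r ^ t = 1 - a" and q: "0 \<le> q" "q ^ t = x"
    using assms by (auto simp: r_def q_def)
  have "1 - x \<le> cocube_growth d t a \<longleftrightarrow> (max 0 (r - d)) ^ t \<le> q ^ t"
    using q by (auto simp: cocube_growth_def r_def)
  also have "\<dots> \<longleftrightarrow> max 0 (r - d) \<le> q" using q(1) assms(2) by (intro power_mono_iff) auto
  also have "\<dots> \<longleftrightarrow> r \<le> q + d" using q by auto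
  also have "\<dots> \<longleftrightarrow> r ^ t \<le> (q + d) ^ t" using q(1) r(1) assms by (intro power_mono_iff[symmetric]) auto
  finally show ?thesis using r by (simp add: cube_growth_def q_def)
qed

lemma cocube_growth_le_1: "cocube_growth d t a \<le> 1"
  by (simp add: cocube_growth_def)

text \<open>The volume that is left over is the inverse of an increasing concave function, hence
  convex.\<close>

lemma cocube_growth_concave:
  assumes d: "0 \<le> d" and t: "0 < t"
  shows "concave_on {..1} (cocube_growth d t)"
  unfolding concave_on_iff
proof (intro conjI ballI allI impI)
  fix a b u v :: real
  assume ab: "a \<in> {..1}" "b \<in> {..1}" and uv: "0 \<le> u" "0 \<le> v" "u + v = 1"
  define x y where "x = 1 - cocube_growth d t a" and "y = 1 - cocube_growth d t b"
  have nn: "0 \<le> x" "0 \<le> y" by (simp_all add: x_def y_def cocube_growth_le_1)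
  have "1 - a \<le> cube_growth d t x"
    using cocube_growth_ge_iff[OF d t nn(1), of a] ab by (simp add: x_def)
  moreover have "1 - b \<le> cube_growth d t y"
    using cocube_growth_ge_iff[OF d t nn(2), of b] ab by (simp add: y_def)
  ultimately have "u * (1 - a) + v * (1 - b) \<le> u * cube_growth d t x + v * cube_growth d t y"
    using uv by (intro add_mono mult_left_mono) auto
  also have "\<dots> \<le> cube_growth d t (u * x + v * y)"
    using cube_growth_concave[OF d t] uv nn by (auto simp: concave_on_iff)
  finally have *: "(u + v) - (u * a + v * b) \<le> cube_growth d t (u * x + v * y)"
    by (simp add: algebra_simps)
  have "u * a + v * b \<le> u * 1 + v * 1" using uv ab by (intro add_mono mult_left_mono) auto
  then have le1: "u * a + v * b \<le> 1" using uv by simp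
  have "1 - (u * x + v * y) \<le> cocube_growth d t (u * a + v * b)"
    using * uv le1 nn cocube_growth_ge_iff[OF d t _ le1, of "u * x + v * y"] by simp
  moreover have "1 - (u * x + v * y) = (u + v) - (u * x + v * y)" using uv by simp
  moreover have "\<dots> = u * cocube_growth d t a + v * cocube_growth d t b"
    by (simp add: x_def y_def algebra_simps)
  ultimately show "u * cocube_growth d t a + v * cocube_growth d t b
      \<le> cocube_growth d t (u *\<^sub>R a + v *\<^sub>R b)" by simp
qed simp

lemma profile_le_1: "profile d n a \<le> 1"
  by (induction n) auto

lemma profile_antimono_dim: "k \<le> n \<Longrightarrow> profile d n a \<le> profile d k a"
  by (induction n) (auto simp: le_Suc_eq min_le_iff_disj)

lemma profile_le_cube:
  assumes "1 \<le> t" "t \<le> n" shows "profile d n a \<le> cube_growth d t a"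
proof -
  obtain s where "t = Suc s" using assms by (cases t) auto
  then show ?thesis using profile_antimono_dim[OF assms(2), of d a] by auto
qed

lemma profile_le_cocube:
  assumes "1 \<le> t" "t \<le> n" shows "profile d n a \<le> cocube_growth d t a"
proof -
  obtain s where "t = Suc s" using assms by (cases t) auto
  then show ?thesis using profile_antimono_dim[OF assms(2), of d a] by auto
qed

lemma profile_cases:
  obtains (one) "profile d n a = 1"
  | (cube) t where "1 \<le> t" "t \<le> n" "profile d n a = cube_growth d t a"
  | (cocube) t where "1 \<le> t" "t \<le> n" "profile d n a = cocube_growth d t a"
proof (induction n arbitrary: thesis)
  case (Suc n)
  show ?case
  proof (cases "profile d (Suc n) a = profile d n a")
    case True
    show ?thesis by (rule Suc.IH) (use True Suc.prems le_SucI in metis)+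
  next
    case False
    then show ?thesis using Suc.prems(2,3)[of "Suc n"] by (auto simp: min_def split: if_splits)
  qed
qed auto

lemma profile_mono:
  "\<lbrakk>0 \<le> a; a \<le> b; 0 \<le> d\<rbrakk> \<Longrightarrow> profile d n a \<le> profile d n b"
proof (induction n)
  case (Suc n)
  then show ?case
    using cube_growth_mono[of a b d "Suc n"] cocube_growth_mono[of a b d "Suc n"]
    by (auto simp: min_le_iff_disj)
qed simp

lemma concave_on_min:
  fixes f g :: "real \<Rightarrow> real"
  assumes "concave_on S f" "concave_on S g"
  shows "concave_on S (\<lambda>x. min (f x) (g x))"
  unfolding concave_on_iff
proof (intro conjI ballI allI impI)
  show "convex S" using assms(1) by (rule concave_on_imp_convex)
next
  fix x y u v :: real
  assume *: "x \<in> S" "y \<in> S" "0 \<le> u" "0 \<le> v" "u + v = 1"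
  have "u * min (f x) (g x) + v * min (f y) (g y) \<le> u * f x + v * f y"
    using * by (intro add_mono mult_left_mono) auto
  moreover have "u * min (f x) (g x) + v * min (f y) (g y) \<le> u * g x + v * g y"
    using * by (intro add_mono mult_left_mono) auto
  ultimately show "u * min (f x) (g x) + v * min (f y) (g y)
      \<le> min (f (u *\<^sub>R x + v *\<^sub>R y)) (g (u *\<^sub>R x + v *\<^sub>R y))"
    using assms * unfolding concave_on_iff by (smt (verit) min_less_iff_conj)
qed

lemma profile_concave:
  assumes d: "0 \<le> d"
  shows "concave_on {0..1} (profile d n)"
proof (induction n)
  case 0
  show ?case by (simp add: concave_on_iff)
next
  case (Suc n)
  have "concave_on {0..1} (cube_growth d (Suc n))" "concave_on {0..1} (cocube_growth d (Suc n))"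
    using cube_growth_concave[OF d, of "Suc n"] cocube_growth_concave[OF d, of "Suc n"]
    by (auto simp: concave_on_def intro: convex_on_subset)
  with Suc show ?case unfolding profile.simps by (intro concave_on_min)
qed

lemma profile_nonneg: "\<lbrakk>0 \<le> a; 0 \<le> d\<rbrakk> \<Longrightarrow> 0 \<le> profile d n a"
proof (induction n)
  case (Suc n)
  have "0 \<le> cocube_growth d (Suc n) a"
  proof -
    have "root (Suc n) (1 - a) \<le> 1" using Suc.prems by simp
    then have "max 0 (root (Suc n) (1 - a) - d) \<le> 1" using Suc.prems by linarith
    then show ?thesis unfolding cocube_growth_def by (simp add: power_le_one del: power_Suc)
  qed
  then show ?case using Suc by (simp add: cube_growth_def)
qed simp

lemma profile_at_1: "0 \<le> d \<Longrightarrow> profile d n 1 = 1"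
  by (induction n) (auto simp: cube_growth_def cocube_growth_def min_def simp del: power_Suc)

lemma profile_le_interval: "1 \<le> n \<Longrightarrow> profile d n a \<le> a + d"
  using profile_le_cube[of 1 n d a] by (simp add: cube_growth_def)

lemma continuous_on_profile: "continuous_on S (profile d n)"
proof (induction n)
  case (Suc n)
  then show ?case unfolding profile.simps cube_growth_def cocube_growth_def
    by (intro continuous_intros) auto
qed (simp)

lemma continuous_on_profile_width: "continuous_on S (\<lambda>d. profile d n a)"
proof (induction n)
  case (Suc n)
  then show ?case unfolding profile.simps cube_growth_def cocube_growth_def
    by (intro continuous_intros) auto
qed (simp)

section \<open>The profile of products and unions with slabs\<close>

text \<open>Hoelder's inequality with \<open>x\<close> the side of a cube and \<open>z\<close> that of its competitor, a box with \<open>t\<close>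
  sides \<open>z\<close> and one side \<open>c = x ^ Suc t / z ^ t\<close>: among such boxes of a given volume the cube
  grows least.\<close>

lemma cube_growth_times_interval:
  assumes "0 \<le> c" "0 \<le> b" "0 \<le> d" "0 < t"
  shows "cube_growth d (Suc t) (c * b) \<le> (c + d) * cube_growth d t b"
proof (cases "b = 0")
  case True
  have "d * d ^ t \<le> (c + d) * d ^ t" using assms by (intro mult_right_mono) auto
  then show ?thesis using True by (simp add: cube_growth_def)
next
  case False
  define z where "z = root t b"
  define g where "g = root (Suc t) (c * b)"
  have z: "0 < z" "z ^ t = b" using False assms by (auto simp: z_def)
  have g: "0 \<le> g" "g ^ Suc t = c * b" using assms by (auto simp: g_def simp del: power_Suc)
  have "(g + d) ^ Suc t \<le> (c * b / b + d) * (z + d) ^ t"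
    using holder_power_shift[OF z(1) g(1) assms(3), of t] unfolding g z .
  then show ?thesis using False by (simp add: cube_growth_def g_def z_def)
qed

text \<open>The complement of a slab of width \<open>c\<close> and a co-cube of volume \<open>u\<close> is a box; by
  \<open>cube_growth_times_interval\<close>, a box shrinks to at most what the cube of the same
  volume shrinks to.\<close>

lemma cocube_growth_join_slab:
  assumes "0 \<le> c" "c + d \<le> 1" "u \<le> 1" "0 \<le> d" "0 < t"
  shows "cocube_growth d (Suc t) (u + c * (1 - u)) \<le> 1 - (1 - c - d) * (1 - cocube_growth d t u)"
proof -
  define s where "s = root t (1 - u)"
  define r where "r = root (Suc t) ((1 - c) * (1 - u))"
  have e: "1 - (u + c * (1 - u)) = (1 - c) * (1 - u)" by (simp add: algebra_simps)
  have s: "0 \<le> s" "s ^ t = 1 - u" using assms by (auto simp: s_def)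
  have "(1 - c - d) * max 0 (s - d) ^ t \<le> max 0 (r - d) ^ Suc t"
  proof (cases "s \<le> d")
    case True
    then show ?thesis using assms by (simp add: max_absorb1 zero_power)
  next
    case False
    define b where "b = (s - d) ^ t"
    define x where "x = (1 - c - d) * b"
    have nn: "0 \<le> b" "0 \<le> 1 - c - d" "0 \<le> x" using False assms by (auto simp: b_def x_def)
    have "cube_growth d (Suc t) x \<le> (1 - c - d + d) * cube_growth d t b"
      unfolding x_def using assms nn by (intro cube_growth_times_interval) auto
    also have "cube_growth d t b = s ^ t"
      unfolding b_def using False assms by (subst cube_growth_power) auto
    finally have "(root (Suc t) x + d) ^ Suc t \<le> (1 - c) * (1 - u)"
      using s by (simp add: cube_growth_def)
    then have "root (Suc t) ((root (Suc t) x + d) ^ Suc t) \<le> r"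
      unfolding r_def by simp
    then have "root (Suc t) x \<le> r - d"
      using nn assms by (subst (asm) real_root_power_cancel) auto
    then have "root (Suc t) x ^ Suc t \<le> max 0 (r - d) ^ Suc t"
      using nn by (intro power_mono) auto
    then have "x \<le> max 0 (r - d) ^ Suc t"
      using nn by (subst (asm) real_root_pow_pos2) auto
    then show ?thesis using False by (simp add: x_def b_def max_absorb2)
  qed
  then show ?thesis unfolding cocube_growth_def e by (simp add: s_def r_def)
qed

text \<open>Think of a set of volume \<open>a\<close> whose slices have volume \<open>M\<close> over an interval of length \<open>c\<close> and
  volume \<open>u\<close> elsewhere; if slices grow according to \<open>f\<close>, its neighbourhood has volume
  \<open>(1 - c - d) * f u + (c + d) * f M\<close>. For fixed \<open>c\<close> and \<open>a\<close> this is concave along the segment of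
  admissible pairs \<open>(u, M)\<close>. One end of the segment is \<open>u = M = a\<close>, with value \<open>f a\<close>. At the other
  end either \<open>u = 0\<close>, a product with an interval, or \<open>M = 1\<close>, a union with a full slab. The weight
  of \<open>f a\<close> is positive; the minimality argument below depends on this.\<close>

lemma two_level_interpolation:
  fixes f :: "real \<Rightarrow> real"
  assumes conc: "concave_on {0..1} f" and f0: "0 \<le> f 0" and f1: "f 1 = 1"
    and c: "0 < c" "c < 1" and d: "0 \<le> d" "c + d \<le> 1"
    and uM: "0 < u" "u < M" "M < 1" and a: "a = u + c * (M - u)"
  obtains (interval) l where "0 < l" "l < 1" "a \<le> c"
      "l * f a + (1 - l) * ((c + d) * f (a / c)) \<le> (1 - c - d) * f u + (c + d) * f M"
  | (slab) l where "0 < l" "l < 1" "c \<le> a" "a < 1"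
      "l * f a + (1 - l) * (1 - (1 - c - d) * (1 - f ((a - c) / (1 - c))))
        \<le> (1 - c - d) * f u + (c + d) * f M"
proof -
  have au: "u < a" using a c uM by simp
  have "c * (M - u) < 1 * (M - u)" using c uM by (intro mult_strict_right_mono) auto
  then have aM: "a < M" using a by simp
  have cd: "0 \<le> 1 - c - d" "0 \<le> c + d" using c d by auto
  have conc': "l * f x + (1 - l) * f y \<le> f (l * x + (1 - l) * y)"
    if "0 \<le> l" "l \<le> 1" "0 \<le> x" "x \<le> 1" "0 \<le> y" "y \<le> 1" for l x y
    using conc that unfolding concave_on_iff
    by (metis (no_types, lifting) add.commute atLeastAtMost_iff diff_add_cancel diff_ge_0_iff_ge real_scaleR_def)
  show thesis
  proof (cases "a \<le> c")
    case True
    \<comment> \<open>The weight for which \<open>u\<close> is the combination of \<open>a\<close> and \<open>0\<close>; the same weight then writes \<open>M\<close> as the combination of \<open>a\<close> and \<open>a / c\<close>.\<close>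
    define l where "l = u / a"
    have l: "0 < l" "l < 1" using au uM by (auto simp: l_def)
    have M1: "(1 - l) * (a / c) = M - u"
    proof -
      have "1 - l = (a - u) / a" unfolding l_def using au uM by (simp add: diff_divide_distrib)
      also have "a - u = c * (M - u)" using a by simp
      finally show ?thesis using au uM c by simp
    qed
    have la: "l * a = u" using au uM by (simp add: l_def)
    have "l * f a + (1 - l) * f 0 \<le> f u"
      using conc'[of l a 0] l la au aM uM by simp
    moreover have "0 \<le> (1 - l) * f 0" using l f0 by simp
    ultimately have u1: "l * f a \<le> f u" by linarith
    have "l * f a + (1 - l) * f (a / c) \<le> f (l * a + (1 - l) * (a / c))"
      using l au aM uM True c by (intro conc') auto
    then have u2: "l * f a + (1 - l) * f (a / c) \<le> f M" unfolding M1 la by simp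
    have "(1 - c - d) * (l * f a) + (c + d) * (l * f a + (1 - l) * f (a / c))
        \<le> (1 - c - d) * f u + (c + d) * f M"
      using u1 u2 cd by (intro add_mono mult_left_mono)
    then show ?thesis using interval[OF l True] by (simp add: algebra_simps)
  next
    case False
    \<comment> \<open>Now \<open>M\<close> is the combination of \<open>a\<close> and \<open>1\<close>, and \<open>u\<close> that of \<open>a\<close> and \<open>U\<close>.\<close>
    define l where "l = (1 - M) / (1 - a)"
    define U where "U = (a - c) / (1 - c)"
    have l: "0 < l" "l < 1" using aM uM by (auto simp: l_def)
    have U: "0 \<le> U" "U \<le> 1" using False c aM uM by (auto simp: U_def)
    have la: "l * (1 - a) = 1 - M" using aM uM by (simp add: l_def)
    have U1: "1 - U = (1 - a) / (1 - c)" unfolding U_def using c by (simp add: field_simps)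
    have "1 - l = (M - a) / (1 - a)" unfolding l_def using aM uM by (simp add: field_simps)
    then have "(1 - l) * (1 - U) = (M - a) / (1 - c)" unfolding U1 using aM uM by simp
    also have "M - a = (1 - c) * (M - u)" using a by (simp add: algebra_simps)
    finally have M1: "(1 - l) * (1 - U) = M - u" using c by simp
    have e1: "l * a + (1 - l) * 1 = M" using la by (simp add: algebra_simps)
    have e2: "l * a + (1 - l) * U = u" using la M1 by (simp add: algebra_simps)
    have u2: "l * f a + (1 - l) * 1 \<le> f M"
      using conc'[of l a 1] l au aM uM f1 unfolding e1 by simp
    have u1: "l * f a + (1 - l) * f U \<le> f u"
      using conc'[of l a U] l au aM uM U unfolding e2 by simp
    have "(1 - c - d) * (l * f a + (1 - l) * f U) + (c + d) * (l * f a + (1 - l) * 1)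
        \<le> (1 - c - d) * f u + (c + d) * f M"
      using u1 u2 cd by (intro add_mono mult_left_mono)
    moreover have "(1 - c - d) * (l * f a + (1 - l) * f U) + (c + d) * (l * f a + (1 - l) * 1)
       = l * f a + (1 - l) * (1 - (1 - c - d) * (1 - f U))" by (simp add: algebra_simps)
    ultimately show ?thesis using slab[OF l] False aM uM by (simp add: U_def)
  qed
qed

text \<open>The heart of the proof: products \<open>interval * optimal set\<close> and unions
  \<open>slab \<union> optimal set\<close> in dimension \<open>Suc n\<close> do not beat the profile.

  When the optimal set in dimension \<open>n\<close> is a cube, the product is a box and Hoelder's inequality
  applies; dually for the union of a slab and a co-cube. The mixed cases, an interval times
  a co-cube and a slab together with a cube, have no direct estimate. Instead let \<open>v\<close> be the
  least value over all products and unions of volume \<open>a\<close>, which exists by compactness, and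
  suppose that \<open>v\<close> is below the profile and attained by a mixed set. This set can be sliced
  in a direction of its cube or co-cube factor. Its slices again take two values, and by
  the induction hypothesis the profile of each slice is at most its actual growth, so the
  two-level expression is at most \<open>v\<close>.
  But \<open>two_level_interpolation\<close> bounds that expression from below by a proper mixture of
  \<open>profile d n a \<ge> profile d (Suc n) a > v\<close> and an end value \<open>\<ge> v\<close>: a contradiction.\<close>

lemma profile_product_step:
  assumes d: "0 < d" "d \<le> 1" and a: "0 < a" "a < 1"
    and IH1: "\<And>k b c. n = Suc k \<Longrightarrow> 0 < b \<Longrightarrow> b \<le> 1 \<Longrightarrow> 0 < c \<Longrightarrow> c + d \<le> 1
      \<Longrightarrow> profile d (Suc k) (c * b) \<le> (c + d) * profile d k b"
    and IH2: "\<And>k u c. n = Suc k \<Longrightarrow> 0 < u \<Longrightarrow> u \<le> 1 \<Longrightarrow> 0 \<le> c \<Longrightarrow> c + d \<le> 1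
      \<Longrightarrow> profile d (Suc k) (u + c * (1 - u)) \<le> 1 - (1 - c - d) * (1 - profile d k u)"
  shows "\<And>c. a \<le> c \<Longrightarrow> c + d \<le> 1 \<Longrightarrow> profile d (Suc n) a \<le> (c + d) * profile d n (a / c)"
    and "\<And>c. 0 \<le> c \<Longrightarrow> c \<le> a \<Longrightarrow> c + d \<le> 1 \<Longrightarrow>
      profile d (Suc n) a \<le> 1 - (1 - c - d) * (1 - profile d n ((a - c) / (1 - c)))"
proof -
  define f where "f = profile d n"
  define F where "F = profile d (Suc n) a"
  define H where "H = (\<lambda>c. (c + d) * f (a / c))"
  define H' where "H' = (\<lambda>c. 1 - (1 - c - d) * (1 - f ((a - c) / (1 - c))))"
  \<comment> \<open>Values of products with an interval of length \<open>c\<close>, and of unions with a slab of width \<open>c\<close>.\<close>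
  define E where "E = H ` {a..1 - d} \<union> H' ` {0..min a (1 - d)}"
  have d0: "0 \<le> d" using d by simp
  have conc: "concave_on {0..1} f" unfolding f_def by (rule profile_concave[OF d0])
  have f0: "0 \<le> f 0" and f1: "f 1 = 1"
    using profile_nonneg[of 0 d n] d by (auto simp: f_def profile_at_1)
  have f_le_1: "f x \<le> 1" for x by (simp add: f_def profile_le_1)
  have Ff: "F \<le> f a" unfolding F_def f_def by (rule profile_antimono_dim) simp
  have F1: "F \<le> 1" unfolding F_def by (rule profile_le_1)
  have Fad: "F \<le> a + d" unfolding F_def by (rule profile_le_interval) simp
  have contf: "continuous_on S f" for S unfolding f_def by (rule continuous_on_profile)
  have "continuous_on {a..1 - d} H"
    unfolding H_def using a d
    by (intro continuous_intros continuous_on_compose2[OF contf[of UNIV]]) auto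
  moreover have "continuous_on {0..min a (1 - d)} H'"
    unfolding H'_def using a d
    by (intro continuous_intros continuous_on_compose2[OF contf[of UNIV]]) auto
  ultimately have "compact E"
    unfolding E_def by (intro compact_Un compact_continuous_image) auto
  moreover have "H' 0 \<in> E" unfolding E_def using a d by auto
  ultimately obtain v where v: "v \<in> E" and vmin: "\<And>w. w \<in> E \<Longrightarrow> v \<le> w"
    using compact_attains_inf[of E] by blast
  \<comment> \<open>If the minimum is below the profile, two-level sets that are not extreme miss it.\<close>
  have strict: "v < (1 - c - d) * f u + (c + d) * f M"
    if "v < F" "0 < c" "c + d \<le> 1" "0 < u" "u < M" "M < 1" "a = u + c * (M - u)" for c u M
  proof -
    have c1: "c < 1" using that d by simp
    have *: "v < l * f a + (1 - l) * w" if "0 < l" "l < 1" "v \<le> w" for l w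
    proof -
      have "l * v + (1 - l) * v < l * f a + (1 - l) * w"
        using \<open>v < F\<close> Ff that by (intro add_less_le_mono mult_left_mono mult_strict_left_mono) auto
      then show ?thesis by (simp add: algebra_simps)
    qed
    from conc f0 f1 \<open>0 < c\<close> c1 d0 \<open>c + d \<le> 1\<close> that(4-7) show ?thesis
    proof (cases rule: two_level_interpolation)
      case (interval l)
      have "H c \<in> E" unfolding E_def using interval that by auto
      from *[OF interval(1,2) vmin[OF this]] interval(4) show ?thesis unfolding H_def by linarith
    next
      case (slab l)
      have "H' c \<in> E" unfolding E_def using slab that by auto
      from *[OF slab(1,2) vmin[OF this]] slab(5) show ?thesis unfolding H'_def by linarith
    qed
  qed
  have "F \<le> v"
  proof (rule ccontr)
    assume "\<not> F \<le> v"
    then have vF: "v < F" by simp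
    from v consider (A) c where "a \<le> c" "c + d \<le> 1" "v = H c"
      | (B) c where "0 \<le> c" "c \<le> a" "c + d \<le> 1" "v = H' c"
      unfolding E_def by auto
    then show False
    proof cases
      case A
      define b where "b = a / c"
      have b: "0 < b" "b \<le> 1" "c * b = a" and c: "0 < c" "c < 1"
        using A a d by (auto simp: b_def)
      have vb: "v = (c + d) * f b" using A by (simp add: H_def b_def)
      have fb: "f b < 1"
      proof (rule ccontr)
        assume "\<not> f b < 1"
        then have "f b = 1" using f_le_1[of b] by simp
        then show False using vb vF Fad A by simp
      qed
      have "f b = profile d n b" by (simp add: f_def)
      then show False
      proof (cases rule: profile_cases[of d n b])
        case one then show False using fb by (simp add: f_def)
      next
        case (cube t)
        have "F \<le> cube_growth d (Suc t) (c * b)"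
          unfolding F_def b using cube by (intro profile_le_cube) auto
        also have "\<dots> \<le> v" unfolding vb f_def cube(3)
          using b c d cube by (intro cube_growth_times_interval) auto
        finally show False using vF by simp
      next
        case (cocube t)
        define s where "s = root t (1 - b)"
        have t0: "0 < t" using cocube by simp
        have s: "0 \<le> s" "s ^ t = 1 - b" "s < 1" using b t0 by (auto simp: s_def)
        have fbs: "f b = 1 - max 0 (s - d) ^ t" using cocube(3) by (simp add: f_def cocube_growth_def s_def)
        have sd: "d < s"
        proof (rule ccontr)
          assume "\<not> d < s"
          then have "max 0 (s - d) = 0" by simp
          then show False using fbs fb t0 by (simp add: zero_power)
        qed
        show False
        proof (cases "t = 1")
          case True
          have "f b = b + d" using fbs sd s True by simp
          then have "f b = cube_growth d 1 b" by (simp add: cube_growth_def)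
          then have "cube_growth d (Suc 1) (c * b) \<le> v" unfolding vb
            using b c d cube_growth_times_interval[of c b d 1] by simp
          moreover have "F \<le> cube_growth d (Suc 1) (c * b)"
            unfolding F_def b using cocube by (intro profile_le_cube) auto
          ultimately show False using vF by simp
        next
          case False
          obtain r where r: "t = Suc r" "1 \<le> r" using False cocube(1) by (cases t) auto
          obtain k where k: "n = Suc k" "r \<le> k" using cocube r by (cases n) auto
          define b' where "b' = 1 - s ^ r"
          have sr: "0 < s ^ r" "s ^ r < 1" using sd d s r by (auto simp: power_less_one_iff)
          have b': "0 < b'" "b' < 1" using sr by (auto simp: b'_def)
          have "f (c * b') \<le> (c + d) * profile d k b'"
            unfolding f_def k(1) using b' c A by (intro IH1[OF k(1)]) auto
          also have "\<dots> \<le> (c + d) * cocube_growth d r b'"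
            using c d r k by (intro mult_left_mono profile_le_cocube) auto
          also have "cocube_growth d r b' = 1 - (s - d) ^ r"
            using sd s r by (simp add: cocube_growth_def b'_def real_root_power_cancel)
          finally have fu: "f (c * b') \<le> (c + d) * (1 - (s - d) ^ r)" .
          have "n \<ge> 1" using k by simp
          then have fM: "f c \<le> c + d" unfolding f_def by (rule profile_le_interval)
          \<comment> \<open>Slicing along a side \<open>s\<close> of the removed cube: the slices that meet the cube have volume \<open>c * b'\<close>, the others \<open>c\<close>.\<close>
          have "v < (1 - (1 - s) - d) * f (c * b') + ((1 - s) + d) * f c"
          proof (rule strict[OF vF])
            show "a = c * b' + (1 - s) * (c - c * b')"
            proof -
              have "c * b' + (1 - s) * (c - c * b') = c * (1 - s ^ t)"
                by (simp add: b'_def r(1) algebra_simps)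
              then show ?thesis using b(3) s(2) by simp
            qed
            show "c * b' < c" using c b' by simp
          qed (use s sd c b' in auto)
          also have "\<dots> \<le> (1 - (1 - s) - d) * ((c + d) * (1 - (s - d) ^ r)) + ((1 - s) + d) * (c + d)"
            using fu fM sd s d by (intro add_mono mult_left_mono) auto
          also have "\<dots> = (c + d) * (1 - (s - d) ^ t)" using r by (simp add: algebra_simps)
          also have "\<dots> = v" using sd vb fbs by simp
          finally show False by simp
        qed
      qed
    next
      case B
      define u where "u = (a - c) / (1 - c)"
      have c: "c < 1" using B a by simp
      have u0: "0 \<le> u" "u < 1" using B a c by (auto simp: u_def)
      have "u * (1 - c) = a - c" using c by (simp add: u_def)
      then have au: "a = u + c * (1 - u)" by (simp add: algebra_simps)
      have vu: "v = 1 - (1 - c - d) * (1 - f u)" using B by (simp add: H'_def u_def)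
      have fu1: "f u < 1"
      proof (rule ccontr)
        assume "\<not> f u < 1"
        then have "f u = 1" using f_le_1[of u] by simp
        then show False using vu vF F1 by simp
      qed
      have c0: "0 < c"
      proof (rule ccontr)
        assume "\<not> 0 < c"
        then have "c = 0" using B by simp
        then have "v = 1 - (1 - d) * (1 - f a)" using vu au by simp
        moreover have "(1 - d) * (1 - f a) \<le> 1 * (1 - f a)"
          using d f_le_1[of a] by (intro mult_right_mono) auto
        ultimately show False using vF Ff by simp
      qed
      have u: "0 < u"
      proof (rule ccontr)
        assume "\<not> 0 < u"
        then have "u = 0" using u0 by simp
        then have ac: "a = c" using au by simp
        have "(1 - c - d) * (1 - f u) \<le> (1 - c - d) * 1"
          using \<open>u = 0\<close> f0 B by (intro mult_left_mono) auto
        then show False using vF Fad ac vu by simp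
      qed
      show False
      proof (cases rule: profile_cases[of d n u])
        case one then show False using fu1 by (simp add: f_def)
      next
        case (cocube t)
        have "F \<le> cocube_growth d (Suc t) (u + c * (1 - u))"
          unfolding F_def au using cocube by (intro profile_le_cocube) auto
        also have "\<dots> \<le> v" unfolding vu f_def cocube(3)
          using u u0 c0 B d cocube by (intro cocube_growth_join_slab) auto
        finally show False using vF by simp
      next
        case (cube t)
        define s where "s = root t u"
        have t0: "0 < t" using cube by simp
        have s: "0 < s" "s ^ t = u" "s < 1" using u u0 t0 by (auto simp: s_def)
        have fus: "f u = (s + d) ^ t" using cube(3) by (simp add: f_def cube_growth_def s_def)
        have sd: "s + d < 1"
        proof (rule ccontr)
          assume "\<not> s + d < 1"
          then have "1 \<le> (s + d) ^ t" by (intro one_le_power) simp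
          then show False using fus fu1 by simp
        qed
        show False
        proof (cases "t = 1")
          case True
          have "f u = cocube_growth d 1 u"
            using fus sd s True by (simp add: cocube_growth_def)
          then have "cocube_growth d (Suc 1) (u + c * (1 - u)) \<le> v" unfolding vu
            using u0 B d by (simp only:) (intro cocube_growth_join_slab, auto)
          moreover have "F \<le> cocube_growth d (Suc 1) (u + c * (1 - u))"
            unfolding F_def au[symmetric] using cube by (intro profile_le_cocube) auto
          ultimately show False using vF by simp
        next
          case False
          obtain r where r: "t = Suc r" "1 \<le> r" using False cube(1) by (cases t) auto
          obtain k where k: "n = Suc k" "r \<le> k" using cube r by (cases n) auto
          define M where "M = s ^ r + c * (1 - s ^ r)"
          have sr: "0 < s ^ r" "s ^ r < 1" using s r by (auto simp: power_less_one_iff)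
          have Mc: "M - c = (1 - c) * s ^ r" "1 - M = (1 - c) * (1 - s ^ r)"
            by (auto simp: M_def algebra_simps)
          then have M: "c < M" "M < 1" using c sr by (smt (verit) mult_pos_pos)+
          have "f M \<le> 1 - (1 - c - d) * (1 - profile d k (s ^ r))"
            unfolding f_def M_def k(1) using sr c0 B by (intro IH2[OF k(1)]) auto
          also have "\<dots> \<le> 1 - (1 - c - d) * (1 - cube_growth d r (s ^ r))"
            using c d r k B by (intro diff_left_mono mult_left_mono profile_le_cube) auto
          also have "cube_growth d r (s ^ r) = (s + d) ^ r"
            using s r by (simp add: cube_growth_power)
          finally have fM: "f M \<le> 1 - (1 - c - d) * (1 - (s + d) ^ r)" .
          have "n \<ge> 1" using k by simp
          then have fc: "f c \<le> c + d" unfolding f_def by (rule profile_le_interval)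
          \<comment> \<open>Slicing along a side \<open>s\<close> of the cube: the slices that meet the cube have volume \<open>M\<close>, the others only the slab, \<open>c\<close>.\<close>
          have "v < (1 - s - d) * f c + (s + d) * f M"
          proof (rule strict[OF vF])
            have "s * (M - c) = (1 - c) * u" unfolding Mc using s(2) r by (simp add: algebra_simps)
            then show "a = c + s * (M - c)" using au by (simp add: algebra_simps)
          qed (use s sd c0 M in auto)
          also have "\<dots> \<le> (1 - s - d) * (c + d) + (s + d) * (1 - (1 - c - d) * (1 - (s + d) ^ r))"
            using fM fc sd s d by (intro add_mono mult_left_mono) auto
          also have "\<dots> = 1 - (1 - c - d) * (1 - (s + d) * (s + d) ^ r)" by (simp add: algebra_simps)
          also have "\<dots> = v" using vu fus r by simp
          finally show False by simp
        qed
      qed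
    qed
  qed
  then have "F \<le> w" if "w \<in> E" for w using vmin[OF that] by simp
  then show "\<And>c. a \<le> c \<Longrightarrow> c + d \<le> 1 \<Longrightarrow> profile d (Suc n) a \<le> (c + d) * profile d n (a / c)"
    and "\<And>c. 0 \<le> c \<Longrightarrow> c \<le> a \<Longrightarrow> c + d \<le> 1 \<Longrightarrow>
      profile d (Suc n) a \<le> 1 - (1 - c - d) * (1 - profile d n ((a - c) / (1 - c)))"
    unfolding F_def E_def H_def H'_def f_def by auto
qed

lemma profile_product:
  assumes d: "0 < d" "d \<le> 1"
  shows "(\<forall>b c. 0 < b \<longrightarrow> b \<le> 1 \<longrightarrow> 0 < c \<longrightarrow> c + d \<le> 1
        \<longrightarrow> profile d (Suc n) (c * b) \<le> (c + d) * profile d n b) \<and>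
    (\<forall>u c. 0 < u \<longrightarrow> u \<le> 1 \<longrightarrow> 0 \<le> c \<longrightarrow> c + d \<le> 1
        \<longrightarrow> profile d (Suc n) (u + c * (1 - u)) \<le> 1 - (1 - c - d) * (1 - profile d n u))"
proof (induction n rule: less_induct)
  case (less n)
  note step = profile_product_step[OF d, of _ n]
  show ?case
  proof (intro conjI allI impI)
    fix b c :: real assume *: "0 < b" "b \<le> 1" "0 < c" "c + d \<le> 1"
    then have cb: "0 < c * b" "c * b \<le> c" using mult_left_mono[of b 1 c] by auto
    then have "c * b < 1" using * d by linarith
    then show "profile d (Suc n) (c * b) \<le> (c + d) * profile d n b"
      using step(1)[of "c * b" c] less.IH cb * by auto
  next
    fix u c :: real assume *: "0 < u" "u \<le> 1" "0 \<le> c" "c + d \<le> 1"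
    have c1: "c < 1" using * d by simp
    show "profile d (Suc n) (u + c * (1 - u)) \<le> 1 - (1 - c - d) * (1 - profile d n u)"
    proof (cases "u = 1")
      case True
      then show ?thesis using d by (simp add: profile_at_1 profile_le_1 del: profile.simps)
    next
      case False
      define a where "a = u + c * (1 - u)"
      have a1: "1 - a = (1 - c) * (1 - u)" and a2: "a - c = (1 - c) * u"
        by (auto simp: a_def algebra_simps)
      have "0 < 1 - a" "0 < a - c" unfolding a1 a2 using * c1 False by auto
      moreover have "(a - c) / (1 - c) = u" unfolding a2 using c1 by simp
      ultimately have "profile d (Suc n) a \<le> 1 - (1 - c - d) * (1 - profile d n u)"
        using step(2)[of a c] less.IH * by auto
      then show ?thesis by (simp only: a_def)
    qed
  qed
qed

lemmas profile_times_interval = conjunct1[OF profile_product, rule_format]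
  and profile_join_slab = conjunct2[OF profile_product, rule_format]

text \<open>An empty slice has an empty neighbourhood, so slices are measured by the profile with value
  \<open>0\<close> at \<open>0\<close>. Lowering the value at an end point of the domain preserves concavity.\<close>

definition profile0 :: "real \<Rightarrow> nat \<Rightarrow> real \<Rightarrow> real" where
  "profile0 d n a = (if a = 0 then 0 else profile d n a)"

lemma profile0_mono:
  "\<lbrakk>0 \<le> a; a \<le> b; 0 \<le> d\<rbrakk> \<Longrightarrow> profile0 d n a \<le> profile0 d n b"
  by (auto simp: profile0_def profile_mono profile_nonneg)

lemma profile0_concave:
  assumes d: "0 \<le> d" shows "concave_on {0..1} (profile0 d n)"
  unfolding concave_on_iff
proof (intro conjI ballI allI impI)
  fix x y u v :: real
  assume *: "x \<in> {0..1}" "y \<in> {0..1}" "0 \<le> u" "0 \<le> v" "u + v = 1"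
  show "u * profile0 d n x + v * profile0 d n y \<le> profile0 d n (u *\<^sub>R x + v *\<^sub>R y)"
  proof (cases "u * x + v * y = 0")
    case True
    moreover have "0 \<le> u * x" "0 \<le> v * y" using * by auto
    ultimately have "u * x = 0" "v * y = 0" by linarith+
    then show ?thesis by (auto simp: profile0_def)
  next
    case False
    have "profile0 d n z \<le> profile d n z" if "0 \<le> z" for z
      using that d by (simp add: profile0_def profile_nonneg)
    then have "u * profile0 d n x + v * profile0 d n y \<le> u * profile d n x + v * profile d n y"
      using * by (intro add_mono mult_left_mono) auto
    also have "\<dots> \<le> profile d n (u *\<^sub>R x + v *\<^sub>R y)"
      using profile_concave[OF d] * unfolding concave_on_iff by blast
    finally show ?thesis using False by (simp add: profile0_def)
  qed
qed simp

text \<open>Along the segment of \<open>two_level_interpolation\<close> a concave function is least at an end point, and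
  the end points are covered by \<open>profile_product\<close>.\<close>

lemma profile_two_level:
  assumes d: "0 < d" "d \<le> 1" and c: "0 \<le> c" "c + d \<le> 1"
    and uM: "0 \<le> u" "u \<le> M" "0 < M" "M \<le> 1"
  shows "profile0 d (Suc n) (u + c * (M - u))
      \<le> (1 - c - d) * profile0 d n u + (c + d) * profile0 d n M"
proof -
  have d0: "0 \<le> d" using d by simp
  have c1: "c < 1" using c d by simp
  have fM: "profile d (Suc n) M \<le> profile d n M" by (rule profile_antimono_dim) simp
  have fu: "profile0 d (Suc n) u \<le> profile0 d n u"
    unfolding profile0_def using profile_antimono_dim[of n "Suc n"] by simp
  consider "u = 0" | "c = 0" | "u = M" | "M = 1" "0 < u"
    | "0 < u" "u < M" "M < 1" "0 < c"
    using uM c by linarith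
  then show ?thesis
  proof cases
    case 1
    show ?thesis
    proof (cases "c = 0")
      case True then show ?thesis using 1 c uM d
        by (simp add: profile0_def profile_nonneg del: profile.simps)
    next
      case False
      then show ?thesis
        using 1 profile_times_interval[OF d, of M c n] uM c by (simp add: profile0_def del: profile.simps)
    qed
  next
    case 2
    have "(1 - d) * profile0 d n u + d * profile0 d n u
        \<le> (1 - d) * profile0 d n u + d * profile0 d n M"
      using d uM by (intro add_left_mono mult_left_mono profile0_mono) auto
    then show ?thesis using 2 fu by (simp add: algebra_simps del: profile.simps)
  next
    case 3
    have "(1 - c - d) * profile0 d n M + (c + d) * profile0 d n M = profile0 d n M"
      by (simp add: algebra_simps)
    then show ?thesis using 3 fu by simp
  next
    case 4
    have "u + c * (1 - u) \<noteq> 0" using 4 uM c by (smt (verit) mult_nonneg_nonneg)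
    then have "profile0 d (Suc n) (u + c * (M - u)) = profile d (Suc n) (u + c * (1 - u))"
      using 4 by (simp add: profile0_def)
    also have "\<dots> \<le> 1 - (1 - c - d) * (1 - profile d n u)"
      using profile_join_slab[OF d] 4 uM c by blast
    also have "\<dots> = (1 - c - d) * profile0 d n u + (c + d) * profile0 d n M"
      using 4 d by (simp add: profile0_def profile_at_1 algebra_simps)
    finally show ?thesis .
  next
    case 5
    define a where "a = u + c * (M - u)"
    have au: "0 < a" using 5 by (simp add: a_def add_pos_pos)
    have fa: "profile d (Suc n) a \<le> profile d n a" by (rule profile_antimono_dim) simp
    have conv: "F \<le> l * x + (1 - l) * y" if "0 < l" "l < 1" "F \<le> x" "F \<le> y" for F l x y :: real
      using convex_bound_le[of "- x" "- F" "- y" l "1 - l"] that by simp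
    have "profile d (Suc n) a \<le> (1 - c - d) * profile d n u + (c + d) * profile d n M"
    proof (cases rule: two_level_interpolation[OF profile_concave[OF d0, of n] profile_nonneg[OF order_refl d0]
          profile_at_1[OF d0] 5(4) c1 d0 c(2) 5(1-3) a_def])
      case (1 l)
      have "profile d (Suc n) (c * (a / c)) \<le> (c + d) * profile d n (a / c)"
        using 1 5 au c by (intro profile_times_interval[OF d]) auto
      then have "profile d (Suc n) a \<le> (c + d) * profile d n (a / c)" using 5 by simp
      from order_trans[OF conv[OF 1(1,2) fa this] 1(4)] show ?thesis .
    next
      case (2 l)
      define U where "U = (a - c) / (1 - c)"
      have e: "U + c * (1 - U) = a"
      proof -
        have "U * (1 - c) = a - c" using c1 by (simp add: U_def)
        then show ?thesis by (simp add: algebra_simps)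
      qed
      have U: "0 \<le> U" "U \<le> 1" using 2 c1 by (auto simp: U_def)
      have "profile d (Suc n) a \<le> 1 - (1 - c - d) * (1 - profile d n U)"
      proof (cases "U = 0")
        case True
        then have "profile d (Suc n) a \<le> c + d" using e profile_le_interval[of "Suc n" d a] by simp
        also have "\<dots> \<le> 1 - (1 - c - d) * (1 - profile d n U)"
        proof -
          have "(1 - c - d) * (1 - profile d n U) \<le> (1 - c - d) * 1"
            using c U d0 by (intro mult_left_mono) (auto intro: profile_nonneg)
          then show ?thesis by simp
        qed
        finally show ?thesis .
      next
        case False
        then show ?thesis using profile_join_slab[OF d, of U c n] U c e by simp
      qed
      from order_trans[OF conv[OF 2(1,2) fa this[unfolded U_def]] 2(5)] show ?thesis .
    qed
    then show ?thesis using 5 au unfolding a_def[symmetric] by (simp add: profile0_def del: profile.simps)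
  qed
qed

section \<open>Neighbourhoods in powers of a finite expander\<close>

definition related_to :: "'a set \<Rightarrow> ('a \<Rightarrow> 'a \<Rightarrow> bool) \<Rightarrow> 'a set \<Rightarrow> 'a set" where
  "related_to V R X = {y \<in> V. \<exists>x\<in>X. R x y}"

text \<open>All that is used of a cycle: a nonempty set \<open>X\<close> has at least \<open>card X + K\<close> neighbours, or else
  everything is a neighbour.\<close>

locale expander =
  fixes V :: "'a set" and R :: "'a \<Rightarrow> 'a \<Rightarrow> bool" and K :: nat
  assumes finite_V: "finite V" and V_nonempty: "V \<noteq> {}"
    and K_pos: "0 < K" and K_le: "K \<le> card V"
    and expansion: "\<And>X. X \<subseteq> V \<Longrightarrow> X \<noteq> {} \<Longrightarrow> min (card V) (card X + K) \<le> card (related_to V R X)"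
begin

lemma finite_related_to: "finite (related_to V R X)"
  using finite_V by (simp add: related_to_def)

text \<open>Add the points of \<open>X\<close> in decreasing order of \<open>h\<close>. The first point has at least \<open>Suc K\<close> neighbours, and each
  further point leaves room for one more, chosen outside the neighbours already used; it is
  adjacent to some point of the current set, hence carries at least the current least value
  of \<open>h\<close>.\<close>

lemma greedy_sum:
  fixes h H :: "'a \<Rightarrow> real"
  assumes "X \<subseteq> V" "card X + K \<le> card V" "z \<in> X"
    and hH: "\<And>x y. x \<in> X \<Longrightarrow> y \<in> V \<Longrightarrow> R x y \<Longrightarrow> h x \<le> H y"
  shows "\<exists>Y \<subseteq> related_to V R X. card Y = card X + K \<and> sum h X + K * h z \<le> sum H Y"
proof -
  have "finite X" using assms(1) finite_V by (rule finite_subset)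
  then show ?thesis using assms
  proof (induction X arbitrary: z rule: finite_ranking_induct[where f = "\<lambda>x. - h x"])
    case empty
    then show ?case by simp
  next
    case (insert x X)
    have xV: "x \<in> V" using insert.prems by simp
    show ?case
    proof (cases "x \<in> X")
      case True
      then show ?thesis using insert.IH[of z] insert.prems by (simp add: insert_absorb)
    next
      case new: False
      show ?thesis
      proof (cases "X = {}")
        case True
        have "1 + K \<le> card (related_to V R {x})"
          using expansion[of "{x}"] insert.prems xV True by simp
        then obtain Y where Y: "Y \<subseteq> related_to V R {x}" "card Y = 1 + K"
          by (meson obtain_subset_with_card_n)
        have "of_nat (card Y) * h x \<le> sum H Y"
          using Y(1) insert.prems(4)[of x] by (intro sum_bounded_below) (auto simp: related_to_def)
        then have "sum h (insert x X) + K * h z \<le> sum H Y"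
          using True insert.prems Y by (simp add: algebra_simps)
        then show ?thesis using Y True by auto
      next
        case False
        obtain z' where z': "z' \<in> X" "h z \<le> h z'"
          using insert.prems(3) insert.hyps False by force
        have cX: "card (insert x X) = Suc (card X)" using new insert.hyps by simp
        obtain Y where Y: "Y \<subseteq> related_to V R X" "card Y = card X + K"
          "sum h X + K * h z' \<le> sum H Y"
          using insert.IH[of z'] insert.prems z' cX by auto
        have finY: "finite Y" using Y(1) finite_related_to by (rule finite_subset)
        have "card Y < card (related_to V R (insert x X))"
          using expansion[of "insert x X"] insert.prems cX Y(2) by simp
        then obtain y where y: "y \<in> related_to V R (insert x X)" "y \<notin> Y"
          using finY by (meson card_mono not_le subsetI)
        obtain w where w: "w \<in> insert x X" "R w y" "y \<in> V"
          using y(1) by (auto simp: related_to_def)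
        have "h x \<le> h w" using w(1) insert.hyps by auto
        also have "\<dots> \<le> H y" using insert.prems(4) w by blast
        finally have hy: "h x \<le> H y" .
        have "K * h z \<le> K * h z'" using z' by (intro mult_left_mono) auto
        then have "sum h (insert x X) + K * h z \<le> sum H (insert y Y)"
          using Y(3) hy y(2) finY new insert.hyps by simp
        moreover have "insert y Y \<subseteq> related_to V R (insert x X)"
          using y(1) Y(1) by (auto simp: related_to_def)
        moreover have "card (insert y Y) = card (insert x X) + K"
          using y(2) Y(2) finY cX by simp
        ultimately show ?thesis by blast
      qed
    qed
  qed
qed

lemma exists_top_subset:
  fixes g :: "'a \<Rightarrow> real"
  assumes "k \<le> card V"
  shows "\<exists>X\<subseteq>V. card X = k \<and> (\<forall>x\<in>X. \<forall>y\<in>V - X. g y \<le> g x)"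
  using assms
proof (induction k)
  case 0
  show ?case by (rule exI[of _ "{}"]) simp
next
  case (Suc k)
  then obtain X where X: "X \<subseteq> V" "card X = k" "\<forall>x\<in>X. \<forall>y\<in>V - X. g y \<le> g x" by auto
  have fin: "finite X" "finite (V - X)" using X(1) finite_V by (auto intro: finite_subset)
  have "V - X \<noteq> {}" using X Suc.prems by auto
  then have "Max (g ` (V - X)) \<in> g ` (V - X)" using fin by (intro Max_in) auto
  then obtain w where w: "w \<in> V - X" "g w = Max (g ` (V - X))" by auto
  have "\<And>y. y \<in> V - X \<Longrightarrow> g y \<le> g w" using w(2) fin by simp
  then have "\<forall>x\<in>insert w X. \<forall>y\<in>V - insert w X. g y \<le> g x" using X(3) w(1) by auto
  then show ?case using X w fin by (intro exI[of _ "insert w X"]) auto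
qed

text \<open>The inductive step in sliced form: \<open>g x\<close> is the relative size of the slice over \<open>x\<close>, and \<open>H y\<close>
  that of the slice of the neighbourhood. Apply \<open>greedy_sum\<close> to the \<open>card V - K\<close> largest slices, whose
  sizes lie between \<open>u\<close> and \<open>M\<close>. The profile lies above its chord over \<open>{u..M}\<close>, so the sum is
  at least the value for two-level slices, with \<open>c\<close> the share of level \<open>M\<close> that gives these
  slices the same total. The remaining slices are bounded by \<open>u\<close>, so that the two-level set is no
  smaller than the given one.\<close>

lemma averaged_growth:
  fixes g H :: "'a \<Rightarrow> real"
  defines "d \<equiv> real K / real (card V)"
  assumes g: "\<And>x. x \<in> V \<Longrightarrow> 0 \<le> g x \<and> g x \<le> 1"
    and H: "\<And>x y. x \<in> V \<Longrightarrow> y \<in> V \<Longrightarrow> R x y \<Longrightarrow> profile0 d n (g x) \<le> H y"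
    and pos: "z \<in> V" "0 < g z"
  shows "card V * profile0 d (Suc n) (sum g V / card V) \<le> sum H V"
proof -
  define m where "m = card V"
  have m: "0 < m" using finite_V V_nonempty by (simp add: m_def card_gt_0_iff)
  have d: "0 < d" "d \<le> 1" using m K_pos K_le by (auto simp: d_def m_def)
  then have d0: "0 \<le> d" by simp
  have Kd: "real K = m * d" using m by (simp add: d_def m_def)
  let ?f = "profile0 d n"
  \<comment> \<open>The maximum with \<open>1\<close> only matters for \<open>K = m\<close>, where a single largest slice suffices.\<close>
  have "max 1 (m - K) \<le> card V" using m by (simp add: m_def)
  from exists_top_subset[OF this, of g] obtain X where X: "X \<subseteq> V" "card X = max 1 (m - K)"
    and top: "\<forall>x\<in>X. \<forall>y\<in>V - X. g y \<le> g x"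
    by blast
  have finX: "finite X" using X(1) finite_V by (rule finite_subset)
  have Xne: "X \<noteq> {}" using X(2) by auto
  define u where "u = Min (g ` X)"
  define M where "M = Max (g ` X)"
  have "M \<in> g ` X" "u \<in> g ` X" unfolding M_def u_def using finX Xne by auto
  then obtain a b where a: "a \<in> X" "g a = M" and b: "b \<in> X" "g b = u" by auto
  have uM: "u \<le> g x" "g x \<le> M" if "x \<in> X" for x
    using that finX by (auto simp: u_def M_def)
  have out: "g y \<le> u" if "y \<in> V - X" for y using top b that by auto
  have aV: "a \<in> V" and bV: "b \<in> V" using a b X(1) by auto
  have u0: "0 \<le> u" using g[OF bV] b(2) by simp
  have uM': "u \<le> M" using uM a by auto
  have gM: "g x \<le> M" if "x \<in> V" for x
  proof (cases "x \<in> X")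
    case True
    then show ?thesis by (rule uM(2))
  next
    case False
    then show ?thesis using out[of x] that uM' by simp
  qed
  have M: "0 < M" "M \<le> 1" using gM[OF pos(1)] pos(2) g[OF aV] a(2) by auto
  have avg0: "0 \<le> sum g V / m" using g by (auto intro!: divide_nonneg_nonneg sum_nonneg)
  show ?thesis
  proof (cases "K < m")
    case False
    then have Km: "K = m" using K_le by (simp add: m_def)
    have "related_to V R {a} = V"
    proof (rule card_seteq[OF finite_V])
      show "related_to V R {a} \<subseteq> V" by (auto simp: related_to_def)
      show "card V \<le> card (related_to V R {a})"
        using expansion[of "{a}"] a X Km by (auto simp: m_def)
    qed
    then have "?f M \<le> H y" if "y \<in> V" for y
      using that H[of a y] a X by (auto simp: related_to_def)
    then have "m * ?f M \<le> sum H V" unfolding m_def by (intro sum_bounded_below)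
    moreover have "profile0 d (Suc n) (sum g V / m) \<le> ?f M"
    proof -
      have "sum g V \<le> m * M" unfolding m_def using gM by (intro sum_bounded_above)
      then have "sum g V / m \<le> M" using m by (simp add: field_simps)
      then have "profile0 d (Suc n) (sum g V / m) \<le> profile0 d (Suc n) M"
        using avg0 d0 by (intro profile0_mono)
      also have "\<dots> \<le> ?f M" unfolding profile0_def by simp
      finally show ?thesis .
    qed
    ultimately show ?thesis
      unfolding m_def by (meson mult_left_mono of_nat_0_le_iff order_trans)
  next
    case True
    have cX: "card X = m - K" using True X(2) by simp
    then have rX: "real (card X) = m * (1 - d)" using True Kd by (simp add: of_nat_diff algebra_simps)
    define W where "W = sum (\<lambda>x. g x - u) X"
    have Wsum: "sum g X = W + card X * u" by (simp add: W_def sum_subtractf)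
    have W0: "0 \<le> W" unfolding W_def using uM by (intro sum_nonneg) auto
    have W1: "W \<le> card X * (M - u)" unfolding W_def using uM by (intro sum_bounded_above) auto
    define c where "c = (if u = M then 0 else W / (m * (M - u)))"
    have cW: "m * (c * (M - u)) = W"
    proof (cases "u = M")
      case True then show ?thesis using W0 W1 by (simp add: c_def)
    next
      case False then show ?thesis using m by (simp add: c_def)
    qed
    have c0: "0 \<le> c" unfolding c_def using W0 uM' by auto
    have c1: "c + d \<le> 1"
    proof (cases "u = M")
      case True then show ?thesis using d by (simp add: c_def)
    next
      case False
      have "m * (M - u) * c \<le> m * (M - u) * (1 - d)"
        using W1 cW unfolding rX by (simp add: algebra_simps)
      then have "c \<le> 1 - d" using False uM' m by (subst (asm) mult_le_cancel_left_pos) auto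
      then show ?thesis by simp
    qed
    have "card X + K \<le> card V" using cX True by (simp add: m_def)
    from greedy_sum[OF X(1) this a(1), of "\<lambda>x. ?f (g x)" H]
    obtain Y where Y: "Y \<subseteq> related_to V R X" "card Y = card X + K"
      "(\<Sum>x\<in>X. ?f (g x)) + K * ?f M \<le> sum H Y"
      using H X(1) a(2) by blast
    have "Y = V"
    proof (rule card_seteq[OF finite_V])
      show "Y \<subseteq> V" using Y(1) by (auto simp: related_to_def)
      show "card V \<le> card Y" using Y(2) cX True by (simp add: m_def)
    qed
    have fsum: "m * ((1 - d) * ?f u + c * (?f M - ?f u)) \<le> (\<Sum>x\<in>X. ?f (g x))"
    proof (cases "u = M")
      case True
      then have "g x = u" if "x \<in> X" for x using uM[OF that] by simp
      then show ?thesis using True rX by simp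
    next
      case False
      then have Mu: "0 < M - u" using uM' by simp
      have chord: "?f u + (g x - u) * ((?f M - ?f u) / (M - u)) \<le> ?f (g x)" if "x \<in> X" for x
      proof -
        define l where "l = (g x - u) / (M - u)"
        have l: "0 \<le> l" "l \<le> 1" using uM[OF that] Mu by (auto simp: l_def)
        have "l * (M - u) = g x - u" using Mu by (simp add: l_def)
        then have e: "(1 - l) * u + l * M = g x" by (simp add: algebra_simps)
        have "(1 - l) * ?f u + l * ?f M \<le> ?f ((1 - l) *\<^sub>R u + l *\<^sub>R M)"
          using l u0 uM' M by (intro concave_onD[OF profile0_concave[OF d0]]) auto
        moreover have "(1 - l) * ?f u + l * ?f M = ?f u + (g x - u) * ((?f M - ?f u) / (M - u))"
          by (simp add: l_def left_diff_distrib right_diff_distrib diff_divide_distrib)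
        ultimately show ?thesis using e by simp
      qed
      have "(\<Sum>x\<in>X. ?f u + (g x - u) * ((?f M - ?f u) / (M - u))) \<le> (\<Sum>x\<in>X. ?f (g x))"
        by (intro sum_mono chord)
      moreover have "(\<Sum>x\<in>X. ?f u + (g x - u) * ((?f M - ?f u) / (M - u)))
          = card X * ?f u + W * ((?f M - ?f u) / (M - u))"
        by (simp only: sum.distrib sum_distrib_right[symmetric] W_def sum_constant)
      moreover have "W * ((?f M - ?f u) / (M - u)) = m * (c * (?f M - ?f u))"
        using Mu by (simp add: cW[symmetric])
      ultimately show ?thesis unfolding rX by (simp add: algebra_simps)
    qed
    have "sum g V = sum g X + sum g (V - X)"
      using X(1) finite_V by (metis add.commute sum.subset_diff)
    also have "sum g (V - X) \<le> card (V - X) * u" using out by (intro sum_bounded_above)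
    also have "real (card (V - X)) = m * d"
      using X(1) finX cX True Kd by (simp add: card_Diff_subset m_def of_nat_diff)
    finally have "sum g V \<le> m * (u + c * (M - u))"
      unfolding Wsum rX using cW by (simp add: algebra_simps)
    then have "sum g V / m \<le> u + c * (M - u)" using m by (simp add: field_simps)
    then have "profile0 d (Suc n) (sum g V / m) \<le> profile0 d (Suc n) (u + c * (M - u))"
      using avg0 d0 by (intro profile0_mono)
    also have "\<dots> \<le> (1 - c - d) * ?f u + (c + d) * ?f M"
      using d c0 c1 u0 uM' M by (rule profile_two_level)
    finally have "m * profile0 d (Suc n) (sum g V / m) \<le> m * ((1 - c - d) * ?f u + (c + d) * ?f M)"
      by (intro mult_left_mono) auto
    also have "\<dots> = m * ((1 - d) * ?f u + c * (?f M - ?f u)) + K * ?f M"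
      unfolding Kd by (simp add: algebra_simps)
    also have "\<dots> \<le> sum H V" using fsum Y(3) \<open>Y = V\<close> by simp
    finally show ?thesis by (simp add: m_def)
  qed
qed

lemma card_slices:
  assumes "i \<notin> I" "finite I" "T \<subseteq> PiE (insert i I) (\<lambda>_. V)"
  shows "card T = (\<Sum>x\<in>V. card {g \<in> PiE I (\<lambda>_. V). g(i := x) \<in> T})"
proof -
  let ?S = "SIGMA x:V. {g \<in> PiE I (\<lambda>_. V). g(i := x) \<in> T}"
  have fin: "finite (PiE I (\<lambda>_. V))" using assms finite_V by (intro finite_PiE) auto
  have image: "(\<lambda>(x, g). g(i := x)) ` ?S = T"
  proof (intro equalityI subsetI)
    fix t assume "t \<in> T"
    then have "t \<in> PiE (insert i I) (\<lambda>_. V)" using assms(3) by blast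
    then have "t \<in> (\<lambda>(y, g). g(i := y)) ` (V \<times> PiE I (\<lambda>_. V))"
      unfolding PiE_insert_eq .
    then obtain p where "p \<in> V \<times> PiE I (\<lambda>_. V)" "t = (case p of (x, g) \<Rightarrow> g(i := x))"
      by (rule imageE)
    then have xg: "fst p \<in> V" "snd p \<in> PiE I (\<lambda>_. V)" "t = (snd p)(i := fst p)"
      by (simp_all add: case_prod_beta mem_Times_iff)
    then have "p \<in> ?S" using \<open>t \<in> T\<close> by (cases p) simp
    then show "t \<in> (\<lambda>(x, g). g(i := x)) ` ?S" by (rule rev_image_eqI) (simp add: xg(3) case_prod_beta)
  next
    fix t assume "t \<in> (\<lambda>(x, g). g(i := x)) ` ?S"
    then show "t \<in> T" by (elim imageE SigmaE) simp
  qed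
  have "?S \<subseteq> V \<times> PiE I (\<lambda>_. V)" by (intro Sigma_mono) simp_all
  then have "inj_on (\<lambda>(x, g). g(i := x)) ?S"
    by (rule inj_on_subset[OF inj_combinator[OF assms(1), of "\<lambda>_. V"]])
  from card_image[OF this] have "card T = card ?S" unfolding image .
  also have "\<dots> = (\<Sum>x\<in>V. card {g \<in> PiE I (\<lambda>_. V). g(i := x) \<in> T})"
    using finite_V fin by (intro card_SigmaI) auto
  finally show ?thesis .
qed

theorem product_growth:
  defines "d \<equiv> real K / real (card V)"
  assumes "finite I" "S \<subseteq> PiE I (\<lambda>_. V)"
  shows "card V ^ card I * profile0 d (card I) (card S / card V ^ card I)
    \<le> card (related_to (PiE I (\<lambda>_. V)) (\<lambda>x y. \<forall>i\<in>I. R (x i) (y i)) S)"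
  using assms(2,3)
proof (induction I arbitrary: S rule: finite_induct)
  case empty
  then have "S \<subseteq> {\<lambda>_. undefined}" by simp
  then consider "S = {}" | "S = {\<lambda>_. undefined}" by blast
  then show ?case
  proof cases
    case 1
    then show ?thesis by (simp add: profile0_def)
  next
    case 2
    then have "related_to (PiE {} (\<lambda>_. V)) (\<lambda>x y. \<forall>i\<in>{}. R (x i) (y i)) S = {\<lambda>_. undefined}"
      by (simp add: related_to_def)
    then show ?thesis using 2 by (simp add: profile0_def)
  qed
next
  case (insert i I)
  let ?P = "PiE I (\<lambda>_. V)"
  let ?N = "related_to (PiE (insert i I) (\<lambda>_. V)) (\<lambda>x y. \<forall>i\<in>insert i I. R (x i) (y i)) S"
  define m where "m = card V"
  have m: "0 < m" using finite_V V_nonempty by (simp add: m_def card_gt_0_iff)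
  have finP: "finite ?P" using insert finite_V by (intro finite_PiE) auto
  have cardP: "card ?P = m ^ card I" using insert by (simp add: card_PiE m_def)
  define slice where "slice = (\<lambda>T x. {g \<in> ?P. g(i := x) \<in> T})"
  define g where "g = (\<lambda>x. card (slice S x) / real (m ^ card I))"
  define H where "H = (\<lambda>y. card (slice ?N y) / real (m ^ card I))"
  have "?N \<subseteq> PiE (insert i I) (\<lambda>_. V)" by (auto simp: related_to_def)
  from card_slices[OF insert.hyps(2,1) this]
  have "real (card ?N) = (\<Sum>y\<in>V. real (card (slice ?N y)))"
    by (simp only: slice_def of_nat_sum)
  also have "\<dots> = sum H V * m ^ card I"
    unfolding H_def sum_divide_distrib[symmetric] using m by simp
  finally have sumH: "sum H V * m ^ card I = card ?N" by simp
  from card_slices[OF insert.hyps(2,1) insert.prems]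
  have "real (card S) = (\<Sum>x\<in>V. real (card (slice S x)))"
    by (simp only: slice_def of_nat_sum)
  also have "\<dots> = sum g V * m ^ card I"
    unfolding g_def sum_divide_distrib[symmetric] using m by simp
  finally have sumg: "sum g V * m ^ card I = card S" by simp
  have gH: "profile0 d (card I) (g x) \<le> H y" if "x \<in> V" "y \<in> V" "R x y" for x y
  proof -
    have "m ^ card I * profile0 d (card I) (g x)
        \<le> card (related_to ?P (\<lambda>x y. \<forall>i\<in>I. R (x i) (y i)) (slice S x))"
    proof -
      have "slice S x \<subseteq> ?P" by (auto simp: slice_def)
      from insert.IH[OF this] show ?thesis by (simp only: g_def m_def of_nat_power)
    qed
    also have "\<dots> \<le> card (slice ?N y)"
    proof (intro of_nat_mono card_mono subsetI)
      show "finite (slice ?N y)" using finP by (simp add: slice_def)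
      fix q assume "q \<in> related_to ?P (\<lambda>x y. \<forall>i\<in>I. R (x i) (y i)) (slice S x)"
      then obtain p where p: "p(i := x) \<in> S" "q \<in> ?P" "\<forall>j\<in>I. R (p j) (q j)"
        unfolding related_to_def slice_def by blast
      have "q(i := y) \<in> PiE (insert i I) (\<lambda>_. V)"
        using that(2) p(2) by (rule PiE_fun_upd)
      moreover have "\<forall>j\<in>insert i I. R ((p(i := x)) j) ((q(i := y)) j)"
        using p(3) insert.hyps(2) that(3) by auto
      ultimately have "q(i := y) \<in> ?N" unfolding related_to_def using p(1) by blast
      then show "q \<in> slice ?N y" using p(2) by (simp add: slice_def)
    qed
    finally show ?thesis unfolding H_def using m by (simp add: pos_le_divide_eq mult.commute)
  qed
  have g01: "0 \<le> g x \<and> g x \<le> 1" for x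
  proof -
    have "card (slice S x) \<le> m ^ card I"
      unfolding cardP[symmetric] using finP by (intro card_mono) (auto simp: slice_def)
    then have "real (card (slice S x)) \<le> real (m ^ card I)" by (rule of_nat_mono)
    then show ?thesis using m by (simp add: g_def)
  qed
  have cI: "card (insert i I) = Suc (card I)" using insert by simp
  show ?case
  proof (cases "\<exists>z\<in>V. 0 < g z")
    case True
    then obtain z where z: "z \<in> V" "0 < g z" by auto
    have "m * profile0 d (Suc (card I)) (sum g V / m) \<le> sum H V"
      unfolding m_def d_def
      by (rule averaged_growth[where g = g and H = H and n = "card I" and z = z])
        (use g01 gH z in \<open>simp_all only: d_def\<close>)
    then have "m * profile0 d (Suc (card I)) (sum g V / m) * m ^ card I \<le> sum H V * m ^ card I"
      by (intro mult_right_mono) auto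
    also have "\<dots> = card ?N" by (rule sumH)
    also have "sum g V / m = card S / (real m * real m ^ card I)"
      unfolding sumg[symmetric] using m by simp
    finally show ?thesis unfolding cI power_Suc m_def[symmetric]
      by (simp only: mult_ac of_nat_mult of_nat_power)
  next
    case False
    have "g x = 0" if "x \<in> V" for x
    proof -
      have "\<not> 0 < g x" using False that by blast
      then show ?thesis using g01[of x] by linarith
    qed
    then have "sum g V = 0" by simp
    then have "card S = 0" using sumg by simp
    then show ?thesis by (simp add: profile0_def)
  qed
qed

end

section \<open>Cycles\<close>

definition cyclic_within :: "nat \<Rightarrow> nat \<Rightarrow> int \<Rightarrow> int \<Rightarrow> bool" where
  "cyclic_within m k a b \<longleftrightarrow> (\<exists>e. \<bar>e\<bar> \<le> int k \<and> b = (a + e) mod int m)"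

lemma cyclic_successor_closed:
  assumes m: "0 < m" and T: "T \<subseteq> {0..<int m}" "t \<in> T"
    and succ: "\<And>t. t \<in> T \<Longrightarrow> (t + 1) mod int m \<in> T"
  shows "T = {0..<int m}"
proof -
  have walk: "(t + int i) mod int m \<in> T" for i
  proof (induction i)
    case 0
    then show ?case using T by (auto simp: subset_iff)
  next
    case (Suc i)
    from succ[OF this] show ?case by (simp add: mod_simps algebra_simps)
  qed
  have "v \<in> T" if "v \<in> {0..<int m}" for v
  proof -
    define i where "i = nat ((v - t) mod int m)"
    have "int i = (v - t) mod int m" using m by (simp add: i_def)
    then have "(t + int i) mod int m = v" using that by (simp add: mod_simps)
    then show ?thesis using walk[of i] by simp
  qed
  then show ?thesis using T by blast
qed

text \<open>Lengthening the interval by one adds a point, since only the whole cycle is closed under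
  successors.\<close>

lemma cyclic_interval_growth:
  assumes m: "0 < m" and X: "X \<subseteq> {0..<int m}" "X \<noteq> {}"
  shows "min m (card X + j) \<le> card ((\<lambda>(a, e). (a + e) mod int m) ` (X \<times> {s..s + int j}))"
proof (induction j)
  case 0
  have "inj_on (\<lambda>a. (a + s) mod int m) X"
  proof (rule inj_onI)
    fix a b assume *: "a \<in> X" "b \<in> X" "(a + s) mod int m = (b + s) mod int m"
    then have "a mod int m = b mod int m" by (metis add_diff_cancel_right' mod_diff_left_eq)
    moreover have "a mod int m = a" "b mod int m = b" using * X by (auto simp: subset_iff)
    ultimately show "a = b" by simp
  qed
  then have "card ((\<lambda>a. (a + s) mod int m) ` X) = card X" by (rule card_image)
  moreover have "(\<lambda>(a, e). (a + e) mod int m) ` (X \<times> {s..s + int 0}) = (\<lambda>a. (a + s) mod int m) ` X"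
    by force
  ultimately show ?case by simp
next
  case (Suc j)
  define T where "T = (\<lambda>j. (\<lambda>(a, e). (a + e) mod int m) ` (X \<times> {s..s + int j}))"
  have TV: "T j \<subseteq> {0..<int m}" for j using m by (auto simp: T_def)
  have fin: "finite (T j)" for j by (rule finite_subset[OF TV]) simp
  have sub: "T j \<subseteq> T (Suc j)" unfolding T_def by (intro image_mono Sigma_mono) auto
  have succ: "(t + 1) mod int m \<in> T (Suc j)" if "t \<in> T j" for t
  proof -
    obtain a e where "a \<in> X" "e \<in> {s..s + int j}" "t = (a + e) mod int m"
      using \<open>t \<in> T j\<close> by (auto simp: T_def)
    then show ?thesis unfolding T_def
      by (intro image_eqI[of _ _ "(a, e + 1)"]) (auto simp: mod_simps add.assoc)
  qed
  have "min m (card X + Suc j) \<le> card (T (Suc j))"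
  proof (cases "\<forall>t\<in>T j. (t + 1) mod int m \<in> T j")
    case True
    obtain a where "a \<in> X" using X by auto
    then have "(a + s) mod int m \<in> T j" by (force simp: T_def)
    from cyclic_successor_closed[OF m TV this] True have "T j = {0..<int m}" by blast
    then have "card (T j) = m" by simp
    then show ?thesis using card_mono[OF fin sub] by simp
  next
    case False
    then obtain t where "t \<in> T j" "(t + 1) mod int m \<notin> T j" by blast
    then have "T j \<subset> T (Suc j)" using succ sub by blast
    then have "card (T j) < card (T (Suc j))" using fin by (rule psubset_card_mono[rotated])
    then show ?thesis using Suc unfolding T_def by simp
  qed
  then show ?case by (simp add: T_def)
qed

lemma expander_cyclic:
  assumes "0 < k" "2 * k \<le> m"
  shows "expander {0..<int m} (cyclic_within m k) (2 * k)"
proof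
  fix X assume X: "X \<subseteq> {0..<int m}" "X \<noteq> {}"
  have "(\<lambda>(a, e). (a + e) mod int m) ` (X \<times> {- int k..- int k + int (2 * k)})
      \<subseteq> related_to {0..<int m} (cyclic_within m k) X"
  proof (intro subsetI)
    fix b assume "b \<in> (\<lambda>(a, e). (a + e) mod int m) ` (X \<times> {- int k..- int k + int (2 * k)})"
    then obtain a e where "a \<in> X" "b = (a + e) mod int m" "\<bar>e\<bar> \<le> int k" by (auto simp: abs_le_iff)
    then show "b \<in> related_to {0..<int m} (cyclic_within m k) X"
      using assms unfolding related_to_def cyclic_within_def by auto
  qed
  moreover have "finite (related_to {0..<int m} (cyclic_within m k) X)"
    by (rule finite_subset[of _ "{0..<int m}"]) (auto simp: related_to_def)
  ultimately have "card ((\<lambda>(a, e). (a + e) mod int m) ` (X \<times> {- int k..- int k + int (2 * k)}))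
      \<le> card (related_to {0..<int m} (cyclic_within m k) X)"
    by (intro card_mono)
  then show "min (card {0..<int m}) (card X + 2 * k) \<le> card (related_to {0..<int m} (cyclic_within m k) X)"
    using cyclic_interval_growth[OF _ X, of "2 * k" "- int k"] assms by simp
next
  show "{0..<int m} \<noteq> {}" using assms by simp
  show "0 < 2 * k" using assms by simp
  show "2 * k \<le> card {0..<int m}" using assms by simp
qed simp

section \<open>The lower bound on the torus\<close>

definition half_open_box :: "real ^ 'n \<Rightarrow> real ^ 'n \<Rightarrow> (real ^ 'n) set" where
  "half_open_box a b = {x. \<forall>i. a $ i \<le> x $ i \<and> x $ i < b $ i}"

text \<open>The box lies between an open and a closed box of the same volume.\<close>

lemma half_open_box_measure:
  fixes a b :: "real ^ 'n"
  assumes "\<And>i. a $ i \<le> b $ i"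
  shows "half_open_box a b \<in> lmeasurable"
    and "measure lebesgue (half_open_box a b) = (\<Prod>i\<in>UNIV. b $ i - a $ i)"
proof -
  have sub: "box a b \<subseteq> half_open_box a b" "half_open_box a b \<subseteq> cbox a b"
    by (auto simp: half_open_box_def mem_box_cart less_imp_le)
  have "half_open_box a b = (\<Inter>i. {x. a $ i \<le> x $ i} \<inter> {x. x $ i < b $ i})"
    by (auto simp: half_open_box_def)
  moreover have "{x. a $ i \<le> x $ i} \<inter> {x. x $ i < b $ i} \<in> sets borel" for i
    by (intro sets.Int borel_closed borel_open closed_Collect_le open_Collect_less continuous_intros)
  ultimately have meas: "half_open_box a b \<in> sets borel"
    by (metis (no_types, lifting) sets.finite_INT finite UNIV_not_empty)
  then have sets: "half_open_box a b \<in> sets lebesgue" by simp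
  show fm: "half_open_box a b \<in> lmeasurable"
    by (rule fmeasurableI2[OF _ sub(2) sets]) simp
  have basis: "\<forall>v\<in>Basis. a \<bullet> v \<le> b \<bullet> v"
    using assms by (auto simp: Basis_vec_def inner_axis)
  have ne: "cbox a b \<noteq> {}" using assms by (simp add: interval_ne_empty_cart)
  have "measure lebesgue (cbox a b) = (\<Prod>i\<in>UNIV. b $ i - a $ i)"
    using content_cbox_cart[OF ne] by simp
  moreover have "measure lebesgue (box a b) = measure lebesgue (cbox a b)"
    using basis by (simp add: measure_lborel_box_eq measure_lborel_cbox_eq)
  moreover have "measure lebesgue (box a b) \<le> measure lebesgue (half_open_box a b)"
    using sub(1) fm by (intro measure_mono_fmeasurable) auto
  moreover have "measure lebesgue (half_open_box a b) \<le> measure lebesgue (cbox a b)"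
    using sub(2) sets by (intro measure_mono_fmeasurable) auto
  ultimately show "measure lebesgue (half_open_box a b) = (\<Prod>i\<in>UNIV. b $ i - a $ i)" by linarith
qed

lemma infnorm_less_iff_cart: "infnorm (x :: real ^ 'n) < r \<longleftrightarrow> (\<forall>i. \<bar>x $ i\<bar> < r)"
proof -
  have "infnorm x < r \<longleftrightarrow> (\<forall>v\<in>Basis. \<bar>x \<bullet> v\<bar> < r)"
    unfolding infnorm_Max by (subst Max_less_iff) auto
  then show ?thesis by (auto simp: Basis_vec_def inner_axis)
qed

text \<open>The periodic preimage in Euclidean space.\<close>

abbreviation lift :: "('n::finite) torus set \<Rightarrow> (real ^ 'n) set" where
  "lift A \<equiv> torus_proj -` A"

lemma torus_proj_eq_iff: "torus_proj x = torus_proj y \<longleftrightarrow> (\<forall>i. x $ i - y $ i \<in> \<int>)"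
  by (simp add: torus.abs_eq_iff torus_rel_def)

lemma torus_proj_eq_in_cube:
  assumes "torus_proj x = torus_proj y" "x \<in> unit_cube" "y \<in> unit_cube"
  shows "x = y"
proof -
  have "x $ i = y $ i" for i
  proof -
    have "x $ i - y $ i \<in> \<int>" using assms(1) by (simp add: torus_proj_eq_iff)
    moreover have "\<bar>x $ i - y $ i\<bar> < 1"
      using assms(2,3) unfolding unit_cube_def by (smt (verit) mem_Collect_eq)
    ultimately show ?thesis using Ints_nonzero_abs_less1 by force
  qed
  then show ?thesis by (simp add: vec_eq_iff)
qed

lemma torus_proj_shift:
  assumes "\<And>i. z $ i \<in> \<int>" shows "torus_proj (x + z) = torus_proj x"
  using assms by (simp add: torus_proj_eq_iff)

lemma lift_torus_nbhd:
  fixes A :: "('n::finite) torus set"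
  shows "lift (torus_nbhd \<delta> A) = {x. \<exists>a\<in>lift A. infnorm (x - a) < \<delta>}"
proof (intro equalityI subsetI)
  fix x assume "x \<in> lift (torus_nbhd \<delta> A)"
  then obtain y a where y: "torus_proj x = torus_proj y" "torus_proj a \<in> A" "infnorm (y - a) < \<delta>"
    unfolding torus_nbhd_eq_image by auto
  have "torus_proj (a + (x - y)) = torus_proj a"
    using y(1) by (intro torus_proj_shift) (simp add: torus_proj_eq_iff)
  then have "a + (x - y) \<in> lift A" "infnorm (x - (a + (x - y))) < \<delta>"
    using y(2,3) by simp_all
  then show "x \<in> {x. \<exists>a\<in>lift A. infnorm (x - a) < \<delta>}" by blast
next
  fix x assume "x \<in> {x. \<exists>a\<in>lift A. infnorm (x - a) < \<delta>}"
  then show "x \<in> lift (torus_nbhd \<delta> A)" unfolding torus_nbhd_eq_image by blast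
qed

lemma unit_cube_half_open_box: "unit_cube = half_open_box 0 1"
  by (simp add: unit_cube_def half_open_box_def)

lemma unit_cube_lmeasurable: "unit_cube \<in> lmeasurable"
  and unit_cube_measure: "measure lebesgue (unit_cube :: (real ^ 'n) set) = 1"
  unfolding unit_cube_half_open_box
  by (rule half_open_box_measure; simp) (subst half_open_box_measure; simp)

lemma lift_lmeasurable:
  assumes "A \<in> sets torus_measure"
  shows "lift A \<inter> unit_cube \<in> lmeasurable"
  using assms by (intro fmeasurableI2[OF unit_cube_lmeasurable]) (auto simp: sets_torus_measure)

lemma measure_torus:
  assumes "A \<in> sets torus_measure"
  shows "measure torus_measure A = measure lebesgue (lift A \<inter> unit_cube)"
  using emeasure_torus_measure[OF assms] by (simp add: measure_def)

lemma torus_nbhd_measurable: "torus_nbhd \<delta> (A :: ('n::finite) torus set) \<in> sets torus_measure"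
proof -
  have "{x. \<exists>a\<in>lift A. infnorm (x - a) < \<delta>} = (\<Union>a\<in>lift A. {x. infnorm (x - a) < \<delta>})"
    by auto
  moreover have "open {x :: real ^ 'n. infnorm (x - a) < \<delta>}" for a
    by (intro open_Collect_less continuous_intros)
  ultimately have "open (lift (torus_nbhd \<delta> A))" unfolding lift_torus_nbhd by auto
  then have "lift (torus_nbhd \<delta> A) \<in> sets lebesgue" by simp
  then show ?thesis unfolding sets_torus_measure using unit_cube_lebesgue by blast
qed

lemma measure_torus_le_1: "measure torus_measure (A :: ('n::finite) torus set) \<le> 1"
proof (cases "A \<in> sets torus_measure")
  case True
  have "measure lebesgue (lift A \<inter> unit_cube) \<le> measure lebesgue (unit_cube :: (real ^ 'n) set)"
    using lift_lmeasurable[OF True] unit_cube_lmeasurable by (intro measure_mono_fmeasurable) auto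
  then show ?thesis by (simp add: measure_torus[OF True] unit_cube_measure)
qed (simp add: measure_notin_sets)

text \<open>The cells are indexed by all integer vectors; those inside the unit cube have indices in
  \<open>{0..<m}\<close>, where the wrap-around of the torus becomes arithmetic modulo \<open>m\<close>.\<close>

definition grid_cell :: "nat \<Rightarrow> ('n \<Rightarrow> int) \<Rightarrow> (real ^ 'n) set" where
  "grid_cell m w = {x. \<forall>i. \<lfloor>real m * x $ i\<rfloor> = w i}"

lemma grid_cell_measure:
  fixes w :: "'n::finite \<Rightarrow> int"
  assumes m: "0 < m"
  shows "grid_cell m w \<in> lmeasurable"
    and "measure lebesgue (grid_cell m w) = 1 / real m ^ CARD('n)"
proof -
  let ?a = "\<chi> i. of_int (w i) / real m" and ?b = "\<chi> i. (of_int (w i) + 1) / real m"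
  have eq: "grid_cell m w = half_open_box ?a ?b"
    using m by (auto simp: grid_cell_def half_open_box_def floor_eq_iff field_simps)
  have le: "?a $ i \<le> ?b $ i" for i by (simp add: divide_right_mono)
  show "grid_cell m w \<in> lmeasurable" unfolding eq by (rule half_open_box_measure(1)[OF le])
  have "measure lebesgue (grid_cell m w) = (\<Prod>i\<in>(UNIV :: 'n set). 1 / real m)"
    unfolding eq half_open_box_measure(2)[OF le] by (simp add: add_divide_distrib)
  then show "measure lebesgue (grid_cell m w) = 1 / real m ^ CARD('n)"
    by (simp add: power_one_over)
qed

lemma grid_cells_measure:
  fixes T :: "('n::finite \<Rightarrow> int) set"
  assumes "0 < m" "finite T"
  shows "measure lebesgue (\<Union>w\<in>T. grid_cell m w) = card T / real m ^ CARD('n)"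
proof -
  have "pairwise (\<lambda>v w. disjnt (grid_cell m v) (grid_cell m w)) T"
  proof (rule pairwiseI)
    fix v w :: "'n \<Rightarrow> int" assume "v \<noteq> w"
    then show "disjnt (grid_cell m v) (grid_cell m w)"
      by (auto simp: disjnt_def grid_cell_def fun_eq_iff)
  qed
  then have "measure lebesgue (\<Union>w\<in>T. grid_cell m w) = (\<Sum>w\<in>T. measure lebesgue (grid_cell m w))"
    using grid_cell_measure(1)[OF assms(1)] assms(2) by (intro measure_UNION') auto
  then show ?thesis by (simp add: grid_cell_measure(2)[OF assms(1)])
qed

lemma grid_cell_in_unit_cube:
  assumes "0 < m" "x \<in> grid_cell m w"
  shows "x \<in> unit_cube \<longleftrightarrow> (\<forall>i. w i \<in> {0..<int m})"
proof -
  have "0 \<le> x $ i \<and> x $ i < 1 \<longleftrightarrow> w i \<in> {0..<int m}" for i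
  proof -
    have "w i = \<lfloor>real m * x $ i\<rfloor>" using assms(2) by (simp add: grid_cell_def)
    moreover have "0 \<le> x $ i \<longleftrightarrow> 0 \<le> \<lfloor>real m * x $ i\<rfloor>"
      using assms(1) by (simp add: zero_le_mult_iff)
    moreover have "x $ i < 1 \<longleftrightarrow> \<lfloor>real m * x $ i\<rfloor> < int m"
      using assms(1) by (simp add: floor_less_iff)
    ultimately show ?thesis by simp
  qed
  then show ?thesis by (simp add: unit_cube_def)
qed

text \<open>The cells that meet \<open>A\<close> cover \<open>A\<close>, so their number is
  at least \<open>\<alpha> * m ^ n\<close>. A cell whose index differs by at most \<open>k\<close> (cyclically) in each coordinate
  from that of a cell meeting \<open>A\<close> lies within \<open>(k + 1) / m \<le> \<delta>\<close> of a point of \<open>A\<close>, so it is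
  contained in the neighbourhood.\<close>

lemma torus_nbhd_grid_bound:
  fixes A :: "('n::finite) torus set" and \<alpha> \<delta> :: real
  assumes A: "A \<in> sets torus_measure" and \<alpha>: "0 < \<alpha>" "\<alpha> \<le> measure torus_measure A"
    and k: "0 < k" "2 * k \<le> m" and \<delta>: "real k + 1 \<le> \<delta> * m"
  shows "profile (real (2 * k) / real m) CARD('n) \<alpha> \<le> measure torus_measure (torus_nbhd \<delta> A)"
proof -
  have m: "0 < m" using k by simp
  define V where "V = {0..<int m}"
  define P where "P = PiE (UNIV :: 'n set) (\<lambda>_. V)"
  define S where "S = {w \<in> P. \<exists>x\<in>lift A. x \<in> grid_cell m w}"
  define T where "T = related_to P (\<lambda>v w. \<forall>i\<in>UNIV. cyclic_within m k (v i) (w i)) S"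
  define d where "d = real (2 * k) / real m"
  have d: "0 \<le> d" by (simp add: d_def)
  have P_iff: "w \<in> P \<longleftrightarrow> (\<forall>i. w i \<in> {0..<int m})" for w
    by (auto simp: P_def V_def PiE_iff)
  have finP: "finite P" unfolding P_def V_def by (intro finite_PiE) auto
  have SP: "S \<subseteq> P" and TP: "T \<subseteq> P" by (auto simp: S_def T_def related_to_def)
  have finS: "finite S" and finT: "finite T" using finite_subset[OF _ finP] SP TP by auto
  have cardV: "card V = m" by (simp add: V_def)
  interpret expander V "cyclic_within m k" "2 * k"
    unfolding V_def using k by (rule expander_cyclic)
  have "measure torus_measure A \<le> measure lebesgue (\<Union>w\<in>S. grid_cell m w)"
    unfolding measure_torus[OF A]
  proof (rule measure_mono_fmeasurable)
    show "lift A \<inter> unit_cube \<in> sets lebesgue" using A by (simp add: sets_torus_measure)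
    show "(\<Union>w\<in>S. grid_cell m w) \<in> lmeasurable"
      using finS grid_cell_measure(1)[OF m] by (intro fmeasurable.finite_UN) auto
    show "lift A \<inter> unit_cube \<subseteq> (\<Union>w\<in>S. grid_cell m w)"
    proof
      fix x assume x: "x \<in> lift A \<inter> unit_cube"
      define w where "w = (\<lambda>i. \<lfloor>real m * x $ i\<rfloor>)"
      have xw: "x \<in> grid_cell m w" by (simp add: grid_cell_def w_def)
      then have "w \<in> P" using x grid_cell_in_unit_cube[OF m xw] by (simp add: P_iff)
      then have "w \<in> S" using x xw by (auto simp: S_def)
      then show "x \<in> (\<Union>w\<in>S. grid_cell m w)" using xw by blast
    qed
  qed
  then have \<alpha>S: "\<alpha> \<le> card S / real m ^ CARD('n)"
    using \<alpha> by (simp add: grid_cells_measure[OF m finS])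
  have "profile d CARD('n) \<alpha> \<le> profile d CARD('n) (card S / real m ^ CARD('n))"
    using \<alpha> \<alpha>S d by (intro profile_mono) auto
  also have "\<dots> = profile0 d CARD('n) (card S / real m ^ CARD('n))"
    using \<alpha>(1) \<alpha>S unfolding profile0_def by (metis not_le)
  also have "\<dots> \<le> card T / real m ^ CARD('n)"
  proof -
    have "real m ^ CARD('n) * profile0 d CARD('n) (card S / real m ^ CARD('n)) \<le> card T"
      using product_growth[of UNIV S] SP unfolding P_def T_def d_def cardV by simp
    then show ?thesis using m by (simp add: pos_le_divide_eq mult.commute)
  qed
  also have "\<dots> = measure lebesgue (\<Union>w\<in>T. grid_cell m w)"
    by (rule grid_cells_measure[OF m finT, symmetric])
  also have "\<dots> \<le> measure torus_measure (torus_nbhd \<delta> A)"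
    unfolding measure_torus[OF torus_nbhd_measurable]
  proof (rule measure_mono_fmeasurable)
    show "(\<Union>w\<in>T. grid_cell m w) \<in> sets lebesgue"
      using finT grid_cell_measure(1)[OF m] by (intro sets.finite_UN) auto
    show "lift (torus_nbhd \<delta> A) \<inter> unit_cube \<in> lmeasurable"
      by (rule lift_lmeasurable[OF torus_nbhd_measurable])
    show "(\<Union>w\<in>T. grid_cell m w) \<subseteq> lift (torus_nbhd \<delta> A) \<inter> unit_cube"
    proof
      fix y assume "y \<in> (\<Union>w\<in>T. grid_cell m w)"
      then obtain w where w: "w \<in> T" "y \<in> grid_cell m w" by blast
      then obtain v where v: "v \<in> S" "\<And>i. cyclic_within m k (v i) (w i)" "w \<in> P"
        by (auto simp: T_def related_to_def)
      obtain x where x: "x \<in> lift A" "x \<in> grid_cell m v" using v(1) by (auto simp: S_def)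
      have "\<exists>e. \<bar>e\<bar> \<le> int k \<and> w i = (v i + e) mod int m" for i
        using v(2)[of i] by (simp add: cyclic_within_def)
      then obtain e where e: "\<And>i. \<bar>e i\<bar> \<le> int k" "\<And>i. w i = (v i + e i) mod int m" by metis
      \<comment> \<open>The number of times that the step from \<open>v\<close> to \<open>w\<close> wraps around; the point of \<open>A\<close> is translated accordingly.\<close>
      define q where "q i = (v i + e i) div int m" for i
      have weq: "w i = v i + e i - int m * q i" for i
        unfolding e(2) q_def by (simp add: minus_mult_div_eq_mod)
      define a where "a = x + (\<chi> i. - of_int (q i))"
      have "torus_proj a = torus_proj x" unfolding a_def by (rule torus_proj_shift) simp
      then have aA: "a \<in> lift A" using x(1) by simp
      have "\<bar>(y - a) $ i\<bar> < \<delta>" for i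
      proof -
        have "\<lfloor>real m * x $ i\<rfloor> = v i" "\<lfloor>real m * y $ i\<rfloor> = w i"
          using x(2) w(2) by (auto simp: grid_cell_def)
        then have fl: "of_int (v i) \<le> real m * x $ i" "real m * x $ i < of_int (v i) + 1"
          "of_int (w i) \<le> real m * y $ i" "real m * y $ i < of_int (w i) + 1"
          by linarith+
        have "real_of_int (w i) = of_int (v i) + of_int (e i) - real m * of_int (q i)"
          unfolding weq by simp
        moreover have "real m * (y - a) $ i = real m * y $ i - real m * x $ i + real m * of_int (q i)"
          by (simp add: a_def algebra_simps)
        ultimately have "\<bar>real m * (y - a) $ i - of_int (e i)\<bar> < 1" using fl by linarith
        moreover have "\<bar>real_of_int (e i)\<bar> \<le> real k" using e(1)[of i] by linarith
        ultimately have "\<bar>real m * (y - a) $ i\<bar> < real k + 1" by linarith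
        also have "real k + 1 \<le> real m * \<delta>" using \<delta> by (simp only: mult.commute)
        finally have "real m * \<bar>(y - a) $ i\<bar> < real m * \<delta>" by (simp only: abs_mult abs_of_nat)
        then show ?thesis using m by simp
      qed
      then have "y \<in> lift (torus_nbhd \<delta> A)"
        unfolding lift_torus_nbhd using aA by (auto simp: infnorm_less_iff_cart)
      moreover have "y \<in> unit_cube"
        using grid_cell_in_unit_cube[OF m w(2)] v(3) by (simp add: P_iff)
      ultimately show "y \<in> lift (torus_nbhd \<delta> A) \<inter> unit_cube" by blast
    qed
  qed
  finally show ?thesis by (simp only: d_def)
qed

text \<open>Refining the grid loses nothing in the limit, because the profile is continuous in the
  width.\<close>

theorem torus_nbhd_lower_bound:
  fixes A :: "('n::finite) torus set" and \<alpha> \<delta> :: real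
  assumes A: "A \<in> sets torus_measure" and \<alpha>: "0 < \<alpha>" "\<alpha> \<le> measure torus_measure A"
    and \<delta>: "0 < \<delta>" "\<delta> \<le> 1 / 2"
  shows "profile (2 * \<delta>) CARD('n) \<alpha> \<le> measure torus_measure (torus_nbhd \<delta> A)"
proof -
  \<comment> \<open>The largest \<open>k\<close> with \<open>k + 1 \<le> \<delta> * m\<close>.\<close>
  define k where "k m = nat (\<lfloor>\<delta> * real m\<rfloor> - 1)" for m
  have width: "(\<lambda>m. real (2 * k m) / real m) \<longlonglongrightarrow> 2 * \<delta>"
    unfolding k_def using \<delta> by real_asymp
  have "isCont (\<lambda>d. profile d CARD('n) \<alpha>) (2 * \<delta>)"
    using continuous_on_profile_width[of UNIV "CARD('n)" \<alpha>] by (simp add: continuous_on_eq_continuous_at)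
  from isCont_tendsto_compose[OF this width]
  have lim: "(\<lambda>m. profile (real (2 * k m) / real m) CARD('n) \<alpha>) \<longlonglongrightarrow> profile (2 * \<delta>) CARD('n) \<alpha>" .
  have "\<forall>\<^sub>F m in sequentially. profile (real (2 * k m) / real m) CARD('n) \<alpha>
      \<le> measure torus_measure (torus_nbhd \<delta> A)"
  proof -
    have "\<forall>\<^sub>F m in sequentially. 2 / \<delta> \<le> real m"
      by (rule eventually_ge_at_top[THEN filterlim_real_sequentially[THEN filterlim_iff[THEN iffD1], rule_format]])
    then show ?thesis
    proof (rule eventually_mono)
      fix m assume "2 / \<delta> \<le> real m"
      then have m2: "2 \<le> \<delta> * real m" using \<delta> by (simp add: field_simps)
      then have f2: "2 \<le> \<lfloor>\<delta> * real m\<rfloor>" by (simp add: le_floor_iff)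
      have km: "real (k m) = of_int \<lfloor>\<delta> * real m\<rfloor> - 1" unfolding k_def using f2 by simp
      have fl: "of_int \<lfloor>\<delta> * real m\<rfloor> \<le> \<delta> * real m" by simp
      have "\<delta> * real m \<le> 1 / 2 * real m" using \<delta> by (intro mult_right_mono) auto
      then have "2 * real (k m) \<le> real m" using km fl by linarith
      then have "2 * k m \<le> m" by linarith
      moreover have "0 < k m" using f2 by (simp add: k_def)
      ultimately show "profile (real (2 * k m) / real m) CARD('n) \<alpha>
          \<le> measure torus_measure (torus_nbhd \<delta> A)"
        using km fl by (intro torus_nbhd_grid_bound[OF A \<alpha>]) auto
    qed
  qed
  with lim show ?thesis
    by (rule tendsto_upperbound) simp
qed

section \<open>Extremal sets\<close>

text \<open>A cube in the coordinates \<open>J\<close>, with the full circle in the others.\<close>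

definition cylinder :: "'n set \<Rightarrow> real \<Rightarrow> real \<Rightarrow> (real ^ 'n) set" where
  "cylinder J p q = {x \<in> unit_cube. \<forall>j\<in>J. p \<le> x $ j \<and> x $ j < q}"

lemma cylinder_measure:
  fixes J :: "('n::finite) set"
  assumes "0 \<le> p" "p \<le> q" "q \<le> 1"
  shows "cylinder J p q \<in> lmeasurable"
    and "measure lebesgue (cylinder J p q) = (q - p) ^ card J"
proof -
  let ?a = "\<chi> i. if i \<in> J then p else 0" and ?b = "\<chi> i. if i \<in> J then q else 1"
  have eq: "cylinder J p q = half_open_box ?a ?b"
  proof (intro set_eqI iffI)
    fix x assume "x \<in> cylinder J p q"
    then show "x \<in> half_open_box ?a ?b" by (auto simp: cylinder_def half_open_box_def unit_cube_def)
  next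
    fix x assume "x \<in> half_open_box ?a ?b"
    then have x: "(if i \<in> J then p else 0) \<le> x $ i" "x $ i < (if i \<in> J then q else 1)" for i
      by (simp_all add: half_open_box_def)
    have "0 \<le> x $ i \<and> x $ i < 1" for i using x[of i] assms by (auto split: if_splits)
    moreover have "p \<le> x $ j \<and> x $ j < q" if "j \<in> J" for j using x[of j] that by simp
    ultimately show "x \<in> cylinder J p q" by (simp add: cylinder_def unit_cube_def)
  qed
  have le: "?a $ i \<le> ?b $ i" for i using assms by simp
  show "cylinder J p q \<in> lmeasurable" unfolding eq by (rule half_open_box_measure(1)[OF le])
  have "measure lebesgue (cylinder J p q) = (\<Prod>i\<in>UNIV. if i \<in> J then q - p else 1)"
    unfolding eq half_open_box_measure(2)[OF le] by (intro prod.cong) auto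
  also have "\<dots> = (q - p) ^ card J" by (simp add: prod.If_cases)
  finally show "measure lebesgue (cylinder J p q) = (q - p) ^ card J" .
qed

lemma lift_image_in_cube:
  assumes "B \<subseteq> unit_cube"
  shows "lift (torus_proj ` B) \<inter> unit_cube = B"
proof (intro equalityI subsetI)
  fix x assume "x \<in> lift (torus_proj ` B) \<inter> unit_cube"
  then obtain y where "y \<in> B" "torus_proj x = torus_proj y" "x \<in> unit_cube" by auto
  then show "x \<in> B" using torus_proj_eq_in_cube[of x y] assms by blast
qed (use assms in auto)

lemma frac_eq_of_Ints_diff:
  fixes x z :: real
  assumes "x - z \<in> \<int>" "0 \<le> x" "x < 1" "0 \<le> z" "z < 1"
  shows "x = z"
  using assms Ints_nonzero_abs_less1[of "x - z"] by fastforce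

text \<open>The cube starts at \<open>\<delta>\<close>, so that its neighbourhood does not wrap around.\<close>

lemma cube_attains:
  assumes a: "0 \<le> a" "a + 2 * \<delta> \<le> 1" and \<delta>: "0 < \<delta>" and t: "t \<le> CARD('n::finite)"
  shows "\<exists>A :: 'n torus set. A \<in> sets torus_measure \<and> measure torus_measure A = a ^ t
     \<and> measure torus_measure (torus_nbhd \<delta> A) \<le> (a + 2 * \<delta>) ^ t"
proof -
  obtain J :: "'n set" where J: "card J = t" using obtain_subset_with_card_n[OF t] by blast
  define B where "B = cylinder J \<delta> (\<delta> + a)"
  define A where "A = torus_proj ` B"
  have B: "B \<in> lmeasurable" "measure lebesgue B = a ^ t"
    unfolding B_def using a \<delta> by (auto intro!: cylinder_measure(1) simp: cylinder_measure(2) J)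
  have cube: "B \<subseteq> unit_cube" by (auto simp: B_def cylinder_def)
  have liftA: "lift A \<inter> unit_cube = B" unfolding A_def by (rule lift_image_in_cube[OF cube])
  have setA: "A \<in> sets torus_measure" using B liftA by (simp add: sets_torus_measure)
  have sub: "lift (torus_nbhd \<delta> A) \<inter> unit_cube \<subseteq> cylinder J 0 (a + 2 * \<delta>)"
  proof
    fix x assume x: "x \<in> lift (torus_nbhd \<delta> A) \<inter> unit_cube"
    then obtain y where y: "y \<in> lift A" "\<And>i. \<bar>(x - y) $ i\<bar> < \<delta>"
      unfolding lift_torus_nbhd by (auto simp: infnorm_less_iff_cart)
    obtain c where c: "c \<in> B" "torus_proj y = torus_proj c" using y(1) by (auto simp: A_def)
    have "0 \<le> x $ j \<and> x $ j < a + 2 * \<delta>" if "j \<in> J" for j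
    proof -
      have cj: "\<delta> \<le> c $ j" "c $ j < \<delta> + a" using c(1) that by (auto simp: B_def cylinder_def)
      have xj: "0 \<le> x $ j" "x $ j < 1" using x by (auto simp: unit_cube_def)
      let ?z = "c $ j + (x - y) $ j"
      have z: "0 \<le> ?z" "?z < a + 2 * \<delta>" using cj y(2)[of j] by linarith+
      have "x $ j - ?z = y $ j - c $ j" by simp
      then have "x $ j - ?z \<in> \<int>" using c(2) by (simp add: torus_proj_eq_iff)
      then have "x $ j = ?z" using xj z a by (intro frac_eq_of_Ints_diff) auto
      then show ?thesis using z by simp
    qed
    then show "x \<in> cylinder J 0 (a + 2 * \<delta>)" using x by (simp add: cylinder_def)
  qed
  have "measure torus_measure (torus_nbhd \<delta> A) \<le> measure lebesgue (cylinder J 0 (a + 2 * \<delta>))"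
    unfolding measure_torus[OF torus_nbhd_measurable]
    using sub lift_lmeasurable[OF torus_nbhd_measurable, of \<delta> A] a \<delta>
    by (intro measure_mono_fmeasurable cylinder_measure(1)) auto
  also have "\<dots> = (a + 2 * \<delta>) ^ t" using a \<delta> by (simp add: cylinder_measure(2) J)
  finally show ?thesis using setA B liftA measure_torus[OF setA] by auto
qed

text \<open>Points of the removed cube at distance at least \<open>\<delta>\<close> from its boundary are not reached.\<close>

lemma cocube_attains:
  assumes s: "2 * \<delta> \<le> s" "s \<le> 1" and \<delta>: "0 < \<delta>" and t: "t \<le> CARD('n::finite)"
  shows "\<exists>A :: 'n torus set. A \<in> sets torus_measure \<and> measure torus_measure A = 1 - s ^ t
     \<and> measure torus_measure (torus_nbhd \<delta> A) \<le> 1 - (s - 2 * \<delta>) ^ t"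
proof -
  obtain J :: "'n set" where J: "card J = t" using obtain_subset_with_card_n[OF t] by blast
  define B where "B = cylinder J 0 s"
  define C where "C = cylinder J \<delta> (s - \<delta>)"
  define A where "A = - (torus_proj ` B)"
  have B: "B \<in> lmeasurable" "measure lebesgue B = s ^ t"
    unfolding B_def using s \<delta> by (auto intro!: cylinder_measure(1) simp: cylinder_measure(2) J)
  have C: "C \<in> lmeasurable" "measure lebesgue C = (s - 2 * \<delta>) ^ t"
    unfolding C_def using s \<delta> by (auto intro!: cylinder_measure(1) simp: cylinder_measure(2) J)
  have cube: "B \<subseteq> unit_cube" "C \<subseteq> unit_cube" by (auto simp: B_def C_def cylinder_def)
  have liftA: "lift A \<inter> unit_cube = unit_cube - B"
    using lift_image_in_cube[OF cube(1)] by (auto simp: A_def)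
  have compl: "measure lebesgue (unit_cube - D) = 1 - measure lebesgue D"
    if "D \<in> lmeasurable" "D \<subseteq> unit_cube" for D :: "(real ^ 'n) set"
    using measurable_measure_Diff[OF unit_cube_lmeasurable fmeasurableD[OF that(1)] that(2)]
    by (simp add: unit_cube_measure)
  have setA: "A \<in> sets torus_measure"
    using B unit_cube_lmeasurable liftA by (auto simp: sets_torus_measure)
  have "x \<notin> C" if x: "x \<in> lift (torus_nbhd \<delta> A)" for x
  proof
    assume xC: "x \<in> C"
    obtain y where y: "y \<in> lift A" "\<And>i. \<bar>(x - y) $ i\<bar> < \<delta>"
      using x unfolding lift_torus_nbhd by (auto simp: infnorm_less_iff_cart)
    define c :: "real ^ 'n" where "c = (\<chi> i. frac (y $ i))"
    have "y $ i - frac (y $ i) \<in> \<int>" for i by (simp add: frac_def)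
    then have yc: "torus_proj y = torus_proj c" by (simp add: torus_proj_eq_iff c_def)
    have "0 \<le> c $ j \<and> c $ j < s" if "j \<in> J" for j
    proof -
      have "\<delta> \<le> x $ j" "x $ j < s - \<delta>" using xC that by (auto simp: C_def cylinder_def)
      moreover have "\<bar>x $ j - y $ j\<bar> < \<delta>" using y(2)[of j] by simp
      ultimately have "0 \<le> y $ j" "y $ j < s" by linarith+
      moreover from this have "frac (y $ j) = y $ j" using s by (simp add: frac_eq)
      ultimately show ?thesis by (simp add: c_def)
    qed
    then have "c \<in> B" by (simp add: B_def cylinder_def unit_cube_def c_def frac_lt_1)
    then show False using y(1) yc by (auto simp: A_def)
  qed
  then have "measure torus_measure (torus_nbhd \<delta> A) \<le> measure lebesgue (unit_cube - C)"
    unfolding measure_torus[OF torus_nbhd_measurable]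
    using lift_lmeasurable[OF torus_nbhd_measurable, of \<delta> A] unit_cube_lmeasurable C(1)
    by (intro measure_mono_fmeasurable fmeasurable.Diff) auto
  then have "measure torus_measure (torus_nbhd \<delta> A) \<le> 1 - (s - 2 * \<delta>) ^ t"
    using compl[OF C(1) cube(2)] C(2) by simp
  moreover have "measure torus_measure A = 1 - s ^ t"
    using measure_torus[OF setA] liftA compl[OF B(1) cube(1)] B(2) by simp
  ultimately show ?thesis using setA by blast
qed

lemma profile_eq_Min:
  assumes "0 \<le> a" "a \<le> 1"
  shows "Min ({1} \<union> (\<Union>t\<in>{1..n}. {(a powr (1 / real t) + d) ^ t,
      1 - (max 0 ((1 - a) powr (1 / real t) - d)) ^ t})) = profile d n a"
proof (induction n)
  case 0
  show ?case by simp
next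
  case (Suc n)
  define g where "g t = {(a powr (1 / real t) + d) ^ t, 1 - (max 0 ((1 - a) powr (1 / real t) - d)) ^ t}" for t :: nat
  have root: "b powr (1 / real (Suc n)) = root (Suc n) b" if "0 \<le> b" for b
    using that by (cases "b = 0") (simp_all add: root_powr_inverse del: of_nat_Suc)
  have "{1} \<union> (\<Union>t\<in>{1..Suc n}. g t) = g (Suc n) \<union> ({1} \<union> (\<Union>t\<in>{1..n}. g t))"
    by (auto simp: atLeastAtMostSuc_conv)
  moreover have "Min (g (Suc n) \<union> ({1} \<union> (\<Union>t\<in>{1..n}. g t)))
      = min (Min (g (Suc n))) (Min ({1} \<union> (\<Union>t\<in>{1..n}. g t)))"
    by (intro Min_Un) (auto simp: g_def)
  ultimately have "Min ({1} \<union> (\<Union>t\<in>{1..Suc n}. g t))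
      = min (Min (g (Suc n))) (Min ({1} \<union> (\<Union>t\<in>{1..n}. g t)))"
    by (simp only:)
  also have "Min ({1} \<union> (\<Union>t\<in>{1..n}. g t)) = profile d n a" using Suc by (simp add: g_def)
  also have "Min (g (Suc n)) = min (cube_growth d (Suc n) a) (cocube_growth d (Suc n) a)"
    unfolding g_def cube_growth_def cocube_growth_def using assms root[of a] root[of "1 - a"]
    by (simp del: power_Suc of_nat_Suc)
  finally show ?case by (simp add: g_def min.commute)
qed

lemma profile_attained:
  assumes "0 < \<alpha>" "\<alpha> \<le> 1" "0 < \<delta>"
  shows "\<exists>A :: ('n::finite) torus set. A \<in> sets torus_measure \<and> \<alpha> \<le> measure torus_measure A
     \<and> measure torus_measure (torus_nbhd \<delta> A) \<le> profile (2 * \<delta>) CARD('n) \<alpha>"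
proof -
  have full: ?thesis if "profile (2 * \<delta>) CARD('n) \<alpha> = 1"
  proof (intro exI conjI)
    show "(UNIV :: 'n torus set) \<in> sets torus_measure" by (simp add: sets_torus_measure unit_cube_lebesgue)
    show "\<alpha> \<le> measure torus_measure (UNIV :: 'n torus set)"
      using assms emeasure_torus_measure_UNIV[where 'n = 'n] by (simp add: measure_def)
    show "measure torus_measure (torus_nbhd \<delta> (UNIV :: 'n torus set)) \<le> profile (2 * \<delta>) CARD('n) \<alpha>"
      using that measure_torus_le_1 by simp
  qed
  show ?thesis
  proof (cases rule: profile_cases[of "2 * \<delta>" "CARD('n)" \<alpha>])
    case one
    then show ?thesis by (rule full)
  next
    case (cube t)
    define a where "a = root t \<alpha>"
    have a: "0 < a" "a ^ t = \<alpha>" using assms cube by (auto simp: a_def)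
    have val: "profile (2 * \<delta>) CARD('n) \<alpha> = (a + 2 * \<delta>) ^ t" using cube by (simp add: cube_growth_def a_def)
    then have "(a + 2 * \<delta>) ^ t \<le> 1" using profile_le_1[of "2 * \<delta>" "CARD('n)" \<alpha>] by simp
    moreover have "0 < t" using cube(1) by simp
    ultimately have "a + 2 * \<delta> \<le> 1" using one_less_power not_le by metis
    then show ?thesis using cube_attains[of a \<delta> t, where 'n = 'n] a assms cube val by force
  next
    case (cocube t)
    define s where "s = root t (1 - \<alpha>)"
    have s: "0 \<le> s" "s \<le> 1" "s ^ t = 1 - \<alpha>" using assms cocube by (auto simp: s_def)
    have val: "profile (2 * \<delta>) CARD('n) \<alpha> = 1 - max 0 (s - 2 * \<delta>) ^ t"
      using cocube by (simp add: cocube_growth_def s_def)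
    show ?thesis
    proof (cases "2 * \<delta> \<le> s")
      case True
      then show ?thesis using cocube_attains[of \<delta> s t, where 'n = 'n] s assms cocube val by force
    next
      case False
      then show ?thesis using val cocube by (intro full) (simp add: zero_power)
    qed
  qed
qed

theorem theorem1p2:
  fixes \<alpha> \<delta> :: real
  assumes "0 < \<alpha>" and "\<alpha> \<le> 1" and "0 < \<delta>" and "\<delta> \<le> 1 / 2"
  shows "is_minimum
     (Min ({1} \<union> (\<Union>t\<in>{1..CARD('n::finite)}.
        {(\<alpha> powr (1 / real t) + 2 * \<delta>) ^ t,
         1 - (max 0 ((1 - \<alpha>) powr (1 / real t) - 2 * \<delta>)) ^ t})))
     {measure torus_measure (torus_nbhd \<delta> A) | A :: 'n torus set.
        A \<in> sets torus_measure \<and> measure torus_measure A \<ge> \<alpha>}"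
proof -
  let ?m = "profile (2 * \<delta>) CARD('n) \<alpha>"
  have lower: "?m \<le> measure torus_measure (torus_nbhd \<delta> A)"
    if "A \<in> sets torus_measure" "\<alpha> \<le> measure torus_measure A" for A :: "'n torus set"
    using torus_nbhd_lower_bound[OF that(1) assms(1) that(2) assms(3,4)] .
  obtain A :: "'n torus set" where A: "A \<in> sets torus_measure" "\<alpha> \<le> measure torus_measure A"
    "measure torus_measure (torus_nbhd \<delta> A) \<le> ?m"
    using profile_attained[OF assms(1-3)] by blast
  have "?m = measure torus_measure (torus_nbhd \<delta> A)" using lower[OF A(1,2)] A(3) by simp
  then have "is_minimum ?m {measure torus_measure (torus_nbhd \<delta> A) | A :: 'n torus set.
        A \<in> sets torus_measure \<and> measure torus_measure A \<ge> \<alpha>}"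
    unfolding is_minimum_def using A lower by blast
  moreover have "0 \<le> \<alpha>" using assms by simp
  ultimately show ?thesis using assms by (subst profile_eq_Min)
qed

end
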